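(* Let $I$ be equipped with nested subdivisions as in the context, and let $X$ be a random variable with values in $J$ and probability density function (PDF) $f$. Assume that $f$ is lower semi-continuous on a Borel set $H\subseteq J$ with $|J\setminus H|=0$. Then the following hold. (A) There is a coupling of $X$ with a random variable $N$ with values in $\mathbb N_0$ such that the distribution of $(X,N)$ is absolutely continuous with respect to $\nu$, the product of Lebesgue measure on $H$ and counting measure on $\mathbb N_0$, with density, for any $(x,n)\in H\times\mathbb N_0$, $$f(x,n)=c_{x_1,\dots,x_n}\quad\text{if }x=.x_1x_2\dots$$ For this coupling, with $S,R,U,E,L$ as defined in the context: (B) For any $n\in\mathbb N_0$, $(x_1,\dots,x_n)\in\mathcal X^n$, $$\mathrm P(S=(x_1,\dots,x_n))=c_{x_1,\dots,x_n}\,\ell_{x_1,\dots,x_n},\qquad \mathrm P(N\le n)=\sum_{(x_1,\dots,x_n)\in\mathcal X^n}i_{x_1,\dots,x_n}\,\ell_{x_1,\dots,x_n},$$ and for any $n\in\mathbb N_0$ and $x=.x_1x_2\dots\in H$ with $f(x)>0$, $$\mathrm P(N\le n\mid X=x)=i_{x_1,\dots,x_n}/f(x).$$ (C) $S$ and $U$ are independent and $U\sim\mathrm{Unif}(0,1)$. Moreover, $R$ conditioned on $S=(x_1,\dots,x_n)$ has finite dimensional distributions $$\mathrm P(R_1=x_{n+1},\dots,R_m=x_{n+m}\mid S=(x_1,\dots,x_n))=\ell_{x_1,\dots,x_{n+m}}/\ell_{x_1,\dots,x_n}$$ whenever $m\in\mathbb N$, $n\in\mathbb N_0$, $(x_1,\dots,x_{n+m})\in\mathcal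 X^{n+m}$ and $\mathrm P(S=(x_1,\dots,x_n))>0$, i.e., $c_{x_1,\dots,x_n}\ell_{x_1,\dots,x_n}>0$. (D) Conditioned on $L$, $S$ and $E$ are independent and $E\sim\mathrm{Unif}(0,L)$.
   Context: Nested subdivisions. $\mathcal X$ is a finite or countable set, $\mathbb N=\{1,2,\dots\}$, $\mathbb N_0=\{0,1,\dots\}$, and $|\cdot|$ is Lebesgue measure. $I=I_\emptyset\subset\mathbb R$ is a Borel set with $\ell_\emptyset=|I|\in(0,\infty)$. For every $n\in\mathbb N$, $I$ is the union of the pairwise disjoint sets $I_{x_1,\dots,x_n}$, $(x_1,\dots,x_n)\in\mathcal X^n$, and $D_n$, where: each $I_k$, $k\in\mathcal X$, is a non-empty open interval; for $n>1$, $I_{x_1,\dots,x_n}$ is an open, possibly empty, interval with $I_{x_1,\dots,x_n}\subseteq I_{x_1,\dots,x_{n-1}}$; $D_n$ is a subset of the endpoints of the non-empty $I_{x_1,\dots,x_n}$'s, and $D_n\subseteq D_{n+1}$. Write $\ell_{x_1,\dots,x_n}=|I_{x_1,\dots,x_n}|$ and assume $\ell_{x_1,\dots,x_n}\to0$ as $n\to\infty$ for every $(x_1,x_2,\dots)\in\mathcal X^{\mathbb N}$. Let $D=\bigcup_nD_n$ (so $|D|=0$) and $J=I\setminus D$. Each $x\in J$ has a unique digit sequence $(x_1,x_2,\dots)\in\mathcal X^{\mathbb N}$ with $x\in I_{x_1,\dots,x_n}$ for all $n\in\mathbb N$, and $x$ is determined by its digits; write $x=.x_1x_2\dots$. If $n=0$,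 $(x_1,\dots,x_n)$ means the empty sequence $\emptyset$, and $\mathcal X^0=\{\emptyset\}$. Lower semi-continuity. $f$ is regarded as a function on $J$; lower semi-continuity of $f$ on $H$ means $\liminf_m f(y_m)\ge f(x)$ for every $x\in H$ and every sequence $y_m\in J$ converging to $x$. The functions $i$ and $c$. $c_\emptyset=i_\emptyset=\inf_Hf$; for $n\in\mathbb N$, $i_{x_1,\dots,x_n}=\inf_{H\cap I_{x_1,\dots,x_n}}f$ if $H\cap I_{x_1,\dots,x_n}\ne\emptyset$ and $i_{x_1,\dots,x_n}=0$ otherwise, and $c_{x_1,\dots,x_n}=i_{x_1,\dots,x_n}-i_{x_1,\dots,x_{n-1}}$. For $n=0$ read $c_{x_1,\dots,x_n}=c_\emptyset$, $i_{x_1,\dots,x_n}=i_\emptyset$, $\ell_{x_1,\dots,x_n}=\ell_\emptyset$. Random quantities. $X=.X_1X_2\dots$ are the digits of $X$. $S=(X_1,\dots,X_N)$ (with $S=\emptyset$ if $N=0$), a discrete random variable with values in $\bigcup_{n\ge0}\mathcal X^n$. $R=(R_1,R_2,\dots)=(X_{N+1},X_{N+2},\dots)$. $L=\ell_{X_1,\dots,X_N}$ (equal to $\ell_\emptyset$ if $N=0$). For $n\in\mathbb N$, $E_n=X-a_{X_1,\dots,X_n}$, where $a_{x_1,\dots,x_n}$ is the left endpoint of $I_{x_1,\dots,x_n}$. $E_0$ is a random variable introduced so that, conditioned on $N=0$, $E_0\sim\mathrm{Unif}(0,\ell_\emptyset)$ independently of $S$ (and accordingly $U_0=E_0/\ell_\emptyset\sim\mathrm{Unif}(0,1)$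 conditionally on $N=0$). Finally $E=E_N$ and $U=E/L$. The conditional probability $\mathrm P(N\le n\mid X=x)$ is the one determined by the joint density: $\sum_{j\le n}f(x,j)/f(x)$. *)

theory Defs
  imports "HOL-Probability.Probability"
begin

text \<open>
  Tuples over the digit alphabet \<open>A\<close> are lists, so the interval with index \<open>(x\<^sub>1,\<dots>,x\<^sub>n)\<close> is
  \<open>Is [x\<^sub>1,\<dots>,x\<^sub>n]\<close>, and \<open>Is []\<close> is the set \<open>I\<close> itself. The exceptional sets \<open>D n\<close> are used for
  \<open>n \<ge> 1\<close> only. Infinite sequences are indexed from 0: \<open>s k\<close> is the digit number \<open>k + 1\<close>.
\<close>

definition words :: "'d set \<Rightarrow> nat \<Rightarrow> 'd list set" where
  "words A n = {xs. set xs \<subseteq> A \<and> length xs = n}"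

text \<open>
  Open intervals are open connected sets of reals (\<open>is_interval\<close>). Those below are contained
  in a set of finite measure, hence bounded, so the endpoints of a non-empty one are its
  infimum and its supremum.
\<close>

locale nested_subdivision =
  fixes A :: "'d set" and I :: "real set" and Is :: "'d list \<Rightarrow> real set" and D :: "nat \<Rightarrow> real set"
  assumes countable_alphabet: "countable A"
    and borel_I: "I \<in> sets borel"
    and pos_I: "0 < emeasure lborel I"
    and finite_I: "emeasure lborel I < \<infinity>"
    and Is_Nil: "Is [] = I"
    and cover: "\<And>n. n \<ge> 1 \<Longrightarrow> I = (\<Union>xs\<in>words A n. Is xs) \<union> D n"
    and disjoint_Is: "\<And>n. n \<ge> 1 \<Longrightarrow> disjoint_family_on Is (words A n)"
    and disjoint_D: "\<And>n xs. n \<ge> 1 \<Longrightarrow> xs \<in> words A n \<Longrightarrow> Is xs \<inter> D n = {}"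
    and first_level: "\<And>k. k \<in> A \<Longrightarrow> Is [k] \<noteq> {} \<and> open (Is [k]) \<and> is_interval (Is [k])"
    and later_levels: "\<And>n xs. n > 1 \<Longrightarrow> xs \<in> words A n \<Longrightarrow>
          open (Is xs) \<and> is_interval (Is xs) \<and> Is xs \<subseteq> Is (butlast xs)"
    and D_endpoints: "\<And>n. n \<ge> 1 \<Longrightarrow>
          D n \<subseteq> (\<Union>xs\<in>{xs \<in> words A n. Is xs \<noteq> {}}. {Inf (Is xs), Sup (Is xs)})"
    and D_mono: "\<And>n. n \<ge> 1 \<Longrightarrow> D n \<subseteq> D (Suc n)"
    and shrink: "\<And>s :: nat \<Rightarrow> 'd. range s \<subseteq> A \<Longrightarrow>
          (\<lambda>n. measure lborel (Is (map s [0..<n]))) \<longlonglongrightarrow> 0"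

definition regular_points :: "real set \<Rightarrow> (nat \<Rightarrow> real set) \<Rightarrow> real set" where
  "regular_points I D = I - (\<Union>n\<in>{1..}. D n)"

definition len :: "('d list \<Rightarrow> real set) \<Rightarrow> 'd list \<Rightarrow> real" where
  "len Is xs = measure lborel (Is xs)"

definition left_end :: "('d list \<Rightarrow> real set) \<Rightarrow> 'd list \<Rightarrow> real" where
  "left_end Is xs = Inf (Is xs)"

definition digits :: "'d set \<Rightarrow> ('d list \<Rightarrow> real set) \<Rightarrow> real \<Rightarrow> nat \<Rightarrow> 'd" where
  "digits A Is x = (THE s. (\<forall>k. s k \<in> A) \<and> (\<forall>n\<ge>1. x \<in> Is (map s [0..<n])))"

definition digit_prefix :: "'d set \<Rightarrow> ('d list \<Rightarrow> real set) \<Rightarrow> real \<Rightarrow> nat \<Rightarrow> 'd list" where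
  "digit_prefix A Is x n = map (digits A Is x) [0..<n]"

definition lsc_within :: "real set \<Rightarrow> real set \<Rightarrow> (real \<Rightarrow> real) \<Rightarrow> bool" where
  "lsc_within J H f \<longleftrightarrow>
     (\<forall>x\<in>H. \<forall>y :: nat \<Rightarrow> real. (\<forall>m. y m \<in> J) \<and> y \<longlonglongrightarrow> x \<longrightarrow>
        ereal (f x) \<le> liminf (\<lambda>m. ereal (f (y m))))"

definition inf_fun :: "('d list \<Rightarrow> real set) \<Rightarrow> real set \<Rightarrow> (real \<Rightarrow> real) \<Rightarrow> 'd list \<Rightarrow> real" where
  "inf_fun Is H f xs =
     (if xs = [] then (INF x\<in>H. f x)
      else if H \<inter> Is xs \<noteq> {} then (INF x\<in>H \<inter> Is xs. f x)
      else 0)"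

definition c_fun :: "('d list \<Rightarrow> real set) \<Rightarrow> real set \<Rightarrow> (real \<Rightarrow> real) \<Rightarrow> 'd list \<Rightarrow> real" where
  "c_fun Is H f xs =
     (if xs = [] then inf_fun Is H f [] else inf_fun Is H f xs - inf_fun Is H f (butlast xs))"

text \<open>The value 0 off \<open>H\<close> is immaterial, since the dominating measure \<open>\<nu>\<close> below charges only \<open>H \<times> \<nat>\<close>.\<close>

definition joint_density ::
    "'d set \<Rightarrow> ('d list \<Rightarrow> real set) \<Rightarrow> real set \<Rightarrow> (real \<Rightarrow> real) \<Rightarrow> real \<Rightarrow> nat \<Rightarrow> real" where
  "joint_density A Is H f x n = (if x \<in> H then c_fun Is H f (digit_prefix A Is x n) else 0)"

definition ref_measure :: "real set \<Rightarrow> (real \<times> nat) measure" where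
  "ref_measure H = density lborel (indicator H) \<Otimes>\<^sub>M count_space UNIV"

text \<open>The conditional probability of \<open>N \<le> n\<close> given \<open>X = x\<close> determined by a joint density \<open>g\<close>
  of \<open>(X, N)\<close> and the density \<open>f\<close> of \<open>X\<close>.\<close>

definition cond_prob_le :: "(real \<Rightarrow> nat \<Rightarrow> real) \<Rightarrow> (real \<Rightarrow> real) \<Rightarrow> nat \<Rightarrow> real \<Rightarrow> real" where
  "cond_prob_le g f n x = (\<Sum>j\<le>n. g x j) / f x"

text \<open>A coupling of \<open>X\<close> (on \<open>M\<close>, with values in \<open>J\<close>) with a random variable \<open>N\<close> with values in the
  natural numbers lives on a probability space \<open>M'\<close> of its own; \<open>X'\<close> is the copy of \<open>X\<close> on it.\<close>

definition coupling ::
    "real set \<Rightarrow> 'a measure \<Rightarrow> ('a \<Rightarrow> real) \<Rightarrow> 'b measure \<Rightarrow> ('b \<Rightarrow> real) \<Rightarrow> ('b \<Rightarrow> nat) \<Rightarrow> bool" where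
  "coupling J M X M' X' N \<longleftrightarrow>
     prob_space M' \<and>
     X' \<in> M' \<rightarrow>\<^sub>M restrict_space lborel J \<and>
     distr M' (restrict_space lborel J) X' = distr M (restrict_space lborel J) X \<and>
     N \<in> M' \<rightarrow>\<^sub>M count_space UNIV"

text \<open>Same as the library's \<open>indep_var\<close>, which however requires both random variables to have
  values in the same type.\<close>

definition indep_rv ::
    "'b measure \<Rightarrow> 's measure \<Rightarrow> ('b \<Rightarrow> 's) \<Rightarrow> 't measure \<Rightarrow> ('b \<Rightarrow> 't) \<Rightarrow> bool" where
  "indep_rv M M1 Y1 M2 Y2 \<longleftrightarrow>
     Y1 \<in> M \<rightarrow>\<^sub>M M1 \<and> Y2 \<in> M \<rightarrow>\<^sub>M M2 \<and>
     prob_space.indep_set M {Y1 -` B \<inter> space M | B. B \<in> sets M1} {Y2 -` B \<inter> space M | B. B \<in> sets M2}"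

text \<open>Conditional distribution given an event of positive probability.\<close>

definition given :: "'b measure \<Rightarrow> ('b \<Rightarrow> bool) \<Rightarrow> 'b measure" where
  "given M P = uniform_measure M {\<omega> \<in> space M. P \<omega>}"

definition has_unif_law :: "'b measure \<Rightarrow> ('b \<Rightarrow> real) \<Rightarrow> real \<Rightarrow> bool" where
  "has_unif_law M Y l \<longleftrightarrow>
     Y \<in> borel_measurable M \<and> distr M lborel Y = uniform_measure lborel {0<..<l}"

definition S_of ::
    "'d set \<Rightarrow> ('d list \<Rightarrow> real set) \<Rightarrow> ('b \<Rightarrow> real) \<Rightarrow> ('b \<Rightarrow> nat) \<Rightarrow> 'b \<Rightarrow> 'd list" where
  "S_of A Is X N \<omega> = digit_prefix A Is (X \<omega>) (N \<omega>)"

text \<open>\<open>R_of A Is X N \<omega> k\<close> is \<open>R\<^sub>k\<^sub>+\<^sub>1\<close>.\<close>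

definition R_of ::
    "'d set \<Rightarrow> ('d list \<Rightarrow> real set) \<Rightarrow> ('b \<Rightarrow> real) \<Rightarrow> ('b \<Rightarrow> nat) \<Rightarrow> 'b \<Rightarrow> nat \<Rightarrow> 'd" where
  "R_of A Is X N \<omega> k = digits A Is (X \<omega>) (N \<omega> + k)"

definition L_of ::
    "'d set \<Rightarrow> ('d list \<Rightarrow> real set) \<Rightarrow> ('b \<Rightarrow> real) \<Rightarrow> ('b \<Rightarrow> nat) \<Rightarrow> 'b \<Rightarrow> real" where
  "L_of A Is X N \<omega> = len Is (S_of A Is X N \<omega>)"

definition E_of ::
    "'d set \<Rightarrow> ('d list \<Rightarrow> real set) \<Rightarrow> ('b \<Rightarrow> real) \<Rightarrow> ('b \<Rightarrow> nat) \<Rightarrow> ('b \<Rightarrow> real) \<Rightarrow> 'b \<Rightarrow> real" where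
  "E_of A Is X N E0 \<omega> =
     (if N \<omega> = 0 then E0 \<omega> else X \<omega> - left_end Is (digit_prefix A Is (X \<omega>) (N \<omega>)))"

definition U_of ::
    "'d set \<Rightarrow> ('d list \<Rightarrow> real set) \<Rightarrow> ('b \<Rightarrow> real) \<Rightarrow> ('b \<Rightarrow> nat) \<Rightarrow> ('b \<Rightarrow> real) \<Rightarrow> 'b \<Rightarrow> real" where
  "U_of A Is X N E0 \<omega> = E_of A Is X N E0 \<omega> / L_of A Is X N \<omega>"

text \<open>The requirement on the auxiliary variable \<open>E\<^sub>0\<close>; it is void if \<open>N = 0\<close> has probability 0.\<close>

definition auxiliary_E0 ::
    "'d set \<Rightarrow> ('d list \<Rightarrow> real set) \<Rightarrow> 'b measure \<Rightarrow> ('b \<Rightarrow> real) \<Rightarrow> ('b \<Rightarrow> nat) \<Rightarrow> ('b \<Rightarrow> real) \<Rightarrow> bool" where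
  "auxiliary_E0 A Is M X N E0 \<longleftrightarrow>
     E0 \<in> borel_measurable M \<and>
     (\<P>(\<omega> in M. N \<omega> = 0) > 0 \<longrightarrow>
        has_unif_law (given M (\<lambda>\<omega>. N \<omega> = 0)) E0 (len Is []) \<and>
        indep_rv (given M (\<lambda>\<omega>. N \<omega> = 0)) (count_space (lists A)) (S_of A Is X N) borel E0)"

end

theory Submission
  imports Defs
begin

text \<open>
  For \<open>x \<in> H\<close> the numbers \<open>i\<close> along the digits of \<open>x\<close> increase with limit \<open>f x\<close>, by lower
  semi-continuity and because the intervals around \<open>x\<close> shrink to \<open>x\<close>. Hence their increments \<open>c\<close>
  are non-negative with sum \<open>f x\<close>, so that \<open>c\<close> is a joint density with first marginal \<open>f\<close>. As \<open>c\<close>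
  is constant on \<open>H \<inter> I\<^bsub>x\<^sub>1,\<dots>,x\<^sub>n\<^esub>\<close>, which is \<open>I\<^bsub>x\<^sub>1,\<dots>,x\<^sub>n\<^esub>\<close> up to a null set, \<open>X\<close> is uniform on
  \<open>I\<^bsub>S\<^esub>\<close> given \<open>S\<close>. All distributional claims follow from this by summing over the countably many
  values of \<open>S\<close>.
\<close>

section \<open>Independence of a countably valued and a real random variable\<close>

text \<open>Three irregularities shape the proof. By convention \<open>\<iota>\<close> is 0 on a
  cell that misses \<open>H\<close>, so \<open>c\<close> can be negative there; as \<open>H\<close>
  has full measure in \<open>I\<close>, such a cell is null and \<open>c\<close> times the measure
  of any Borel part of it is 0. Level 0 differs from all others: \<open>I\<close> is an arbitrary
  Borel set, on which X minus a left endpoint need not be uniform, so \<open>E0\<close> takes its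
  place; the geometry of intervals starts at n = 1 and the empty word is treated apart. Finally, the
  claims concern every coupling with the given joint law, on any space, so they are derived from one
  quantity: the probability of X \<in> C and N = n for C inside a level-n cell, where the joint
  density is constant. The law of E given S depends on S through the length of the cell alone.
  Dividing by that length removes the dependence, which makes U independent of S; fixing L removes
  it too, which gives the statement conditioned on L.\<close>

lemma (in finite_measure) has_sum_measure_UN:
  assumes "countable K" "\<And>i. i \<in> K \<Longrightarrow> F i \<in> sets M" "disjoint_family_on F K"
  shows "((\<lambda>i. measure M (F i)) has_sum measure M (\<Union>i\<in>K. F i)) K"
proof -
  have nn: "(\<integral>\<^sup>+i. ennreal (measure M (F i)) \<partial>count_space K) = ennreal (measure M (\<Union>i\<in>K. F i))"
    using emeasure_UN_countable[OF assms(2,1,3)] unfolding emeasure_eq_measure by (rule sym)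
  \<comment> \<open>Finiteness of the measure turns the integral over counting measure into a
    Bochner integral, hence into an absolutely summable family of reals.\<close>
  have bi: "has_bochner_integral (count_space K) (\<lambda>i. measure M (F i)) (measure M (\<Union>i\<in>K. F i))"
    by (rule has_bochner_integral_nn_integral[OF _ _ _ nn]) auto
  then have abs: "Infinite_Set_Sum.abs_summable_on (\<lambda>i. measure M (F i)) K"
      and sum: "infsetsum (\<lambda>i. measure M (F i)) K = measure M (\<Union>i\<in>K. F i)"
    by (simp_all only: Infinite_Set_Sum.abs_summable_on_def infsetsum_def has_bochner_integral_iff)
  have "(\<lambda>i. measure M (F i)) summable_on K"
    using abs_summable_equivalent[THEN iffD2, OF abs] by (rule abs_summable_summable)
  then show ?thesis
    using has_sum_infsum[of "\<lambda>i. measure M (F i)" K] sum infsetsum_infsum[OF abs] by metis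
qed

lemma measure_lborel_translate:
  fixes a :: real
  assumes "T \<in> sets borel"
  shows "measure lborel {x. a + x \<in> T} = measure lborel T"
proof -
  have "measure lborel T = measure (distr lborel borel ((+) a)) T"
    by (simp add: lborel_distr_plus)
  also have "\<dots> = measure lborel {x. a + x \<in> T}"
    using assms by (subst measure_distr) (auto simp: vimage_def)
  finally show ?thesis by simp
qed

text \<open>Summing the product formula over the values of \<open>S\<close> in a set T gives it for
  the event S \<in> T. The choice T = \<open>W\<close> shows that \<open>Q\<close> is the law of
  \<open>Y\<close>, and then the general formula is independence.\<close>

lemma indep_rv_and_law_of_countable:
  fixes Y :: "'b \<Rightarrow> real"
  assumes "prob_space M" "countable W"
    and S: "S \<in> M \<rightarrow>\<^sub>M count_space W" and Y: "Y \<in> borel_measurable M"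
    and Q: "prob_space Q" "sets Q = sets borel"
    and eq: "\<And>s B. s \<in> W \<Longrightarrow> B \<in> sets borel \<Longrightarrow>
      \<P>(\<omega> in M. S \<omega> = s \<and> Y \<omega> \<in> B) = \<P>(\<omega> in M. S \<omega> = s) * measure Q B"
  shows "indep_rv M (count_space W) S borel Y" "distr M lborel Y = Q"
proof -
  interpret prob_space M by fact
  interpret Q: prob_space Q by fact
  have W: "S \<omega> \<in> W" if "\<omega> \<in> space M" for \<omega>
    using measurable_space[OF S that] by simp
  have S': "{\<omega> \<in> space M. S \<omega> = s} \<in> events" if "s \<in> W" for s
    using measurable_sets[OF S, of "{s}"] that by (simp add: vimage_def Int_def conj_commute)
  have Y': "{\<omega> \<in> space M. Y \<omega> \<in> B} \<in> events" if "B \<in> sets borel" for B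
    using measurable_sets[OF Y that] by (simp add: vimage_def Int_def conj_commute)
  have SY: "{\<omega> \<in> space M. S \<omega> = s \<and> Y \<omega> \<in> B} \<in> events" if "s \<in> W" "B \<in> sets borel" for s B
    using sets.Int[OF S'[OF that(1)] Y'[OF that(2)]] by (simp add: Int_def conj_ac cong: conj_cong)
  have decomp: "emeasure M {\<omega> \<in> space M. S \<omega> \<in> T \<and> Y \<omega> \<in> B} =
      (\<integral>\<^sup>+s. emeasure M {\<omega> \<in> space M. S \<omega> = s \<and> Y \<omega> \<in> B} \<partial>count_space T)"
    if T: "T \<subseteq> W" and B: "B \<in> sets borel" for T B
  proof -
    have "{\<omega> \<in> space M. S \<omega> \<in> T \<and> Y \<omega> \<in> B} = (\<Union>s\<in>T. {\<omega> \<in> space M. S \<omega> = s \<and> Y \<omega> \<in> B})"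
      by auto
    then show ?thesis using T B SY countable_subset[OF T \<open>countable W\<close>]
      by (simp only:) (intro emeasure_UN_countable, auto simp: disjoint_family_on_def)
  qed
  have SYeq: "emeasure M {\<omega> \<in> space M. S \<omega> = s \<and> Y \<omega> \<in> B} =
      emeasure M {\<omega> \<in> space M. S \<omega> = s} * emeasure Q B" if "s \<in> W" "B \<in> sets borel" for s B
    using eq[OF that] by (simp add: emeasure_eq_measure Q.emeasure_eq_measure ennreal_mult)
  have joint: "emeasure M {\<omega> \<in> space M. S \<omega> \<in> T \<and> Y \<omega> \<in> B} =
      emeasure M {\<omega> \<in> space M. S \<omega> \<in> T} * emeasure Q B"
    if T: "T \<subseteq> W" and B: "B \<in> sets borel" for T B
  proof -
    have "emeasure M {\<omega> \<in> space M. S \<omega> \<in> T \<and> Y \<omega> \<in> B} =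
        (\<integral>\<^sup>+s. emeasure M {\<omega> \<in> space M. S \<omega> = s} * emeasure Q B \<partial>count_space T)"
      unfolding decomp[OF T B] using T B SYeq by (intro nn_integral_cong) auto
    also have "\<dots> = (\<integral>\<^sup>+s. emeasure M {\<omega> \<in> space M. S \<omega> = s} \<partial>count_space T) * emeasure Q B"
      by (rule nn_integral_multc) simp
    also have "(\<integral>\<^sup>+s. emeasure M {\<omega> \<in> space M. S \<omega> = s} \<partial>count_space T) = emeasure M {\<omega> \<in> space M. S \<omega> \<in> T}"
      using decomp[OF T, of UNIV] by simp
    finally show ?thesis .
  qed
  have law: "emeasure M {\<omega> \<in> space M. Y \<omega> \<in> B} = emeasure Q B" if B: "B \<in> sets borel" for B
  proof -
    have "{\<omega> \<in> space M. S \<omega> \<in> W \<and> Y \<omega> \<in> B} = {\<omega> \<in> space M. Y \<omega> \<in> B}"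
        "{\<omega> \<in> space M. S \<omega> \<in> W} = space M"
      using W by auto
    then show ?thesis using joint[OF order_refl B] emeasure_space_1 by simp
  qed
  show "distr M lborel Y = Q"
  proof (rule measure_eqI)
    fix B assume "B \<in> sets (distr M lborel Y)"
    then have "B \<in> sets borel" by simp
    then show "emeasure (distr M lborel Y) B = emeasure Q B"
      using law Y by (subst emeasure_distr) (auto simp: vimage_def Int_def conj_commute)
  qed (simp add: Q)
  show "indep_rv M (count_space W) S borel Y"
    unfolding indep_rv_def
  proof (intro conjI S Y indep_setI subsetI)
    fix a b
    assume "a \<in> {S -` B \<inter> space M | B. B \<in> sets (count_space W)}"
      and "b \<in> {Y -` B \<inter> space M | B. B \<in> sets borel}"
    then obtain T B where TB: "T \<subseteq> W" "a = S -` T \<inter> space M" "B \<in> sets borel" "b = Y -` B \<inter> space M"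
      by auto
    have "a \<inter> b = {\<omega> \<in> space M. S \<omega> \<in> T \<and> Y \<omega> \<in> B}" "a = {\<omega> \<in> space M. S \<omega> \<in> T}"
        "b = {\<omega> \<in> space M. Y \<omega> \<in> B}"
      using TB by auto
    then show "prob (a \<inter> b) = prob a * prob b"
      using joint[OF TB(1,3)] law[OF TB(3)]
      by (simp add: measure_def enn2real_mult)
  next
    show "x \<in> events" if "x \<in> {S -` B \<inter> space M | B. B \<in> sets (count_space W)}" for x
      using that measurable_sets[OF S] by auto
    show "x \<in> events" if "x \<in> {Y -` B \<inter> space M | B. B \<in> sets borel}" for x
      using that measurable_sets[OF Y] by auto
  qed
qed

section \<open>Conditioning on an event of positive probability\<close>

lemma (in prob_space) measure_given:
  assumes "{\<omega> \<in> space M. P \<omega>} \<in> events" "{\<omega> \<in> space M. R \<omega>} \<in> events"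
    and "\<P>(\<omega> in M. P \<omega>) > 0"
  shows "\<P>(\<omega> in given M P. R \<omega>) = \<P>(\<omega> in M. P \<omega> \<and> R \<omega>) / \<P>(\<omega> in M. P \<omega>)"
proof -
  have "{\<omega> \<in> space M. P \<omega>} \<inter> {\<omega> \<in> space M. R \<omega>} = {\<omega> \<in> space M. P \<omega> \<and> R \<omega>}"
    "emeasure M {\<omega> \<in> space M. P \<omega>} \<noteq> 0"
    using assms(3) by (auto simp: emeasure_eq_measure)
  then show ?thesis
    using assms by (simp add: given_def)
qed

text \<open>Dividing the assumed formula by the probability of \<open>P\<close> gives the hypothesis
  of the unconditional lemma on the space \<open>given M P\<close>, which has the same measurable
  sets as \<open>M\<close>.\<close>

lemma indep_rv_and_law_given:
  fixes Y :: "'b \<Rightarrow> real"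
  assumes "prob_space M" "countable W"
    and S: "S \<in> M \<rightarrow>\<^sub>M count_space W" and Y: "Y \<in> borel_measurable M"
    and P: "{\<omega> \<in> space M. P \<omega>} \<in> sets M" "\<P>(\<omega> in M. P \<omega>) > 0"
    and Q: "prob_space Q" "sets Q = sets borel"
    and eq: "\<And>s B. s \<in> W \<Longrightarrow> B \<in> sets borel \<Longrightarrow>
      \<P>(\<omega> in M. P \<omega> \<and> S \<omega> = s \<and> Y \<omega> \<in> B) = \<P>(\<omega> in M. P \<omega> \<and> S \<omega> = s) * measure Q B"
  shows "indep_rv (given M P) (count_space W) S borel Y" "distr (given M P) lborel Y = Q"
proof -
  interpret prob_space M by fact
  have m: "measurable (given M P) = measurable M"
    by (intro ext measurable_cong_sets) (auto simp: given_def)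
  have "prob_space (given M P)"
    unfolding given_def using P by (intro prob_space_uniform_measure) (auto simp: emeasure_eq_measure)
  note 1 = indep_rv_and_law_of_countable[OF this \<open>countable W\<close> _ _ Q, of S Y, unfolded m, OF S Y]
  have "\<P>(\<omega> in given M P. S \<omega> = s \<and> Y \<omega> \<in> B) = \<P>(\<omega> in given M P. S \<omega> = s) * measure Q B"
    if "s \<in> W" "B \<in> sets borel" for s B
  proof -
    have 2: "{\<omega> \<in> space M. S \<omega> = s} \<in> events"
      using measurable_sets[OF S, of "{s}"] that by (simp add: vimage_def Int_def conj_commute)
    have "{\<omega> \<in> space M. Y \<omega> \<in> B} \<in> events"
      using measurable_sets[OF Y that(2)] by (simp add: vimage_def Int_def conj_commute)
    from sets.Int[OF 2 this] have "{\<omega> \<in> space M. S \<omega> = s \<and> Y \<omega> \<in> B} \<in> events"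
      by (simp add: Int_def conj_ac cong: conj_cong)
    then show ?thesis using 2 P eq[OF that] by (simp add: measure_given)
  qed
  then show "indep_rv (given M P) (count_space W) S borel Y" "distr (given M P) lborel Y = Q"
    using 1 by auto
qed

section \<open>Uniform laws on intervals\<close>

lemma prob_space_uniform_interval: "0 < l \<Longrightarrow> prob_space (uniform_measure lborel {0<..<l::real})"
  by (intro prob_space_uniform_measure) auto

lemma measure_uniform_interval:
  assumes "0 < (l::real)" "B \<in> sets borel"
  shows "measure (uniform_measure lborel {0<..<l}) B = measure lborel ({0<..<l} \<inter> B) / l"
  using assms by (subst measure_uniform_measure) auto

lemma measure_uniform_interval_scale:
  assumes l: "0 < (l::real)" and B: "B \<in> sets borel"
  shows "measure (uniform_measure lborel {0<..<l}) {e. e / l \<in> B} = measure (uniform_measure lborel {0<..<1}) B"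
proof -
  have B': "{e. e / l \<in> B} \<in> sets borel" using B by measurable
  have "emeasure lborel ({0<..<l} \<inter> {e. e / l \<in> B}) =
      (\<integral>\<^sup>+x. indicator ({0<..<l} \<inter> {e. e / l \<in> B}) x \<partial>lborel)"
    using B' by (intro nn_integral_indicator[symmetric]) auto
  also have "\<dots> = l * (\<integral>\<^sup>+x. indicator ({0<..<l} \<inter> {e. e / l \<in> B}) (0 + l * x) \<partial>lborel)"
    using B' l by (subst nn_integral_real_affine[where c = l and t = 0]) auto
  also have "(\<integral>\<^sup>+x. indicator ({0<..<l} \<inter> {e. e / l \<in> B}) (0 + l * x) \<partial>lborel) =
      (\<integral>\<^sup>+x. indicator ({0<..<1} \<inter> B) x \<partial>lborel)"
    using l by (intro nn_integral_cong) (auto simp: indicator_def zero_less_mult_iff)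
  also have "\<dots> = emeasure lborel ({0<..<1} \<inter> B)"
    using B by (intro nn_integral_indicator) auto
  finally have "measure lborel ({0<..<l} \<inter> {e. e / l \<in> B}) = l * measure lborel ({0<..<1} \<inter> B)"
    using l by (simp add: measure_def enn2real_mult)
  then show ?thesis using l B B' by (simp add: measure_uniform_interval)
qed

section \<open>Digits\<close>

text \<open>Finite measure forces boundedness. Openness then excludes the infimum and the supremum,
  and convexity supplies every point between them.\<close>

lemma open_interval_real_eq:
  fixes S :: "real set"
  assumes "open S" "is_interval S" "S \<noteq> {}" "emeasure lborel S < \<infinity>"
  shows "S = {Inf S<..<Inf S + measure lborel S}" "0 < measure lborel S"
proof -
  have bdd: "bounded S"
  proof (rule ccontr)
    obtain z where z: "z \<in> S" using assms by auto
    assume "\<not> bounded S"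
    then have *: "\<exists>y\<in>S. \<bar>y\<bar> > e" for e
      unfolding bounded_iff real_norm_def by (meson not_le)
    have "ennreal (real n) \<le> emeasure lborel S" for n
    proof -
      \<comment> \<open>This bound puts \<open>y\<close> at distance more than n from
        \<open>z\<close>, so the segment joining them lies in \<open>S\<close> and has length at
        least n.\<close>
      obtain y where y: "y \<in> S" "\<bar>y\<bar> > \<bar>z\<bar> + real n" using *[of "\<bar>z\<bar> + real n"] by auto
      have "{min y z..max y z} \<subseteq> S"
        using mem_is_interval_1_I[OF assms(2), of "min y z" "max y z"] y(1) z
        by (auto simp: min_def max_def)
      then have "emeasure lborel {min y z..max y z} \<le> emeasure lborel S"
        using assms(1) by (intro emeasure_mono) auto
      moreover have "real n \<le> max y z - min y z" using y(2) by linarith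
      ultimately show ?thesis
        using order_trans[OF ennreal_leI[of "real n" "max y z - min y z"]]
          emeasure_lborel_Icc[of "min y z" "max y z"] by auto
    qed
    moreover obtain n where "emeasure lborel S < of_nat n"
      using ennreal_Ex_less_of_nat[of "emeasure lborel S"] assms(4) by auto
    ultimately show False
      unfolding ennreal_of_nat_eq_real_of_nat using leD by blast
  qed
  then have b: "bdd_below S" "bdd_above S" by (auto dest: bounded_imp_bdd_below bounded_imp_bdd_above)
  define a b where "a = Inf S" and "b = Sup S"
  have eq: "S = {a<..<b}"
  proof (intro set_eqI iffI)
    fix x assume x: "x \<in> S"
    then obtain e where e: "e > 0" "ball x e \<subseteq> S" using assms(1) openE by blast
    have "x - e/2 \<in> S" "x + e/2 \<in> S" using e by (auto simp: subset_iff dist_real_def)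
    then have "a \<le> x - e/2" "x + e/2 \<le> b"
      using b by (auto intro: cInf_lower cSup_upper simp: a_def b_def)
    then show "x \<in> {a<..<b}" using e(1) by auto
  next
    fix x assume "x \<in> {a<..<b}"
    then obtain y z where "y \<in> S" "z \<in> S" "y < x" "x < z"
      using assms(3) b by (auto simp: cInf_less_iff less_cSup_iff a_def b_def)
    then show "x \<in> S" using mem_is_interval_1_I[OF assms(2), of y z x] by simp
  qed
  have lt: "a < b" using assms(3) unfolding eq by simp
  show "S = {Inf S<..<Inf S + measure lborel S}" "0 < measure lborel S"
    using lt by (simp_all add: eq)
qed

lemma digit_prefix_add:
  "digit_prefix A Is x (n + m) = digit_prefix A Is x n @ map (\<lambda>k. digits A Is x (n + k)) [0..<m]"
  by (rule nth_equalityI) (auto simp: digit_prefix_def nth_append)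

context nested_subdivision
begin

abbreviation J where "J \<equiv> regular_points I D"

lemma in_words_iff: "xs \<in> words A n \<longleftrightarrow> xs \<in> lists A \<and> length xs = n"
  by (auto simp: words_def)

lemma countable_words: "countable (words A n)"
  by (rule countable_subset[OF _ countable_lists[OF countable_alphabet]]) (auto simp: words_def)

lemma open_interval_Is:
  assumes "xs \<in> words A n" "n \<ge> 1"
  shows "open (Is xs)" "is_interval (Is xs)"
proof -
  have "open (Is xs) \<and> is_interval (Is xs)"
  proof (cases "n = 1")
    case True
    then obtain k where "xs = [k]" "k \<in> A"
      using assms by (auto simp: words_def length_Suc_conv)
    then show ?thesis using first_level by auto
  next
    case False
    then show ?thesis using later_levels[of n xs] assms by auto
  qed
  then show "open (Is xs)" "is_interval (Is xs)" by auto
qed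

lemma Is_subset_I: "xs \<in> words A n \<Longrightarrow> Is xs \<subseteq> I"
  using cover[of n] Is_Nil by (cases "n = 0") (auto simp: words_def)

lemma Is_subset_butlast: "xs \<in> words A n \<Longrightarrow> Is xs \<subseteq> Is (butlast xs)"
proof (cases "n > 1")
  case False
  assume *: "xs \<in> words A n"
  then have "butlast xs = []" using False by (cases xs) (auto simp: words_def)
  then show ?thesis using Is_subset_I[OF *] Is_Nil by simp
qed (use later_levels in auto)

lemma Is_subset_prefix: "xs @ ys \<in> lists A \<Longrightarrow> Is (xs @ ys) \<subseteq> Is xs"
proof (induction ys rule: rev_induct)
  case (snoc y ys)
  then show ?case
    using Is_subset_butlast[of "xs @ ys @ [y]" "length (xs @ ys @ [y])"]
    by (auto simp: in_words_iff butlast_append)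
qed simp

lemma borel_Is: "xs \<in> words A n \<Longrightarrow> Is xs \<in> sets borel"
  using open_interval_Is(1)[of xs n] borel_I Is_Nil
  by (cases "n = 0") (auto simp: words_def)

lemma finite_Is: "xs \<in> words A n \<Longrightarrow> emeasure lborel (Is xs) < \<infinity>"
  by (rule order_le_less_trans[OF emeasure_mono[OF Is_subset_I[of xs n]] finite_I])
    (simp_all add: borel_I)

lemma countable_D: "countable (\<Union>n\<in>{1..}. D n)"
proof (rule countable_UN)
  fix n :: nat assume "n \<in> {1..}"
  then have "D n \<subseteq> (\<Union>xs\<in>{xs \<in> words A n. Is xs \<noteq> {}}. {Inf (Is xs), Sup (Is xs)})"
    using D_endpoints by simp
  then show "countable (D n)"
    by (rule countable_subset) (auto intro!: countable_UN countable_subset[OF _ countable_words])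
qed simp

lemma borel_D: "(\<Union>n\<in>{1..}. D n) \<in> sets borel"
  using countable_D by (rule sets.countable[rotated]) auto

lemma borel_J: "J \<in> sets borel"
  unfolding regular_points_def using borel_I borel_D by blast

lemma null_D: "emeasure lborel (\<Union>n\<in>{1..}. D n) = 0"
  using countable_D by (rule emeasure_lborel_countable)

lemma Is_eq:
  assumes "xs \<in> words A n" "n \<ge> 1" "Is xs \<noteq> {}"
  shows "Is xs = {left_end Is xs<..<left_end Is xs + len Is xs}" "0 < len Is xs"
  using open_interval_real_eq[OF open_interval_Is[OF assms(1,2)] assms(3) finite_Is[OF assms(1)]]
  by (simp_all add: left_end_def len_def)

lemma len_Nil_pos: "0 < len Is []"
  using pos_I finite_I by (auto simp: len_def Is_Nil measure_def enn2real_positive_iff)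

lemma word_of_regular_point:
  assumes "x \<in> J" "n \<ge> 1"
  shows "\<exists>!xs. xs \<in> words A n \<and> x \<in> Is xs"
proof -
  have "x \<in> (\<Union>xs\<in>words A n. Is xs)"
    using assms cover[OF assms(2)] by (auto simp: regular_points_def)
  then show ?thesis
    using disjoint_Is[OF assms(2)] by (auto simp: disjoint_family_on_def)
qed

text \<open>The unique words \<open>w n\<close> of the cells around \<open>x\<close> are compatible:
  by nesting, the cell of \<open>butlast (w (Suc n))\<close> contains \<open>x\<close> too, so this
  word is \<open>w n\<close>. Hence all of them are prefixes of a single sequence.\<close>

lemma ex1_digits:
  assumes "x \<in> J"
  shows "\<exists>!s. (\<forall>k. s k \<in> A) \<and> (\<forall>n\<ge>1. x \<in> Is (map s [0..<n]))"
proof -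
  define w where "w n = (THE xs. xs \<in> words A n \<and> x \<in> Is xs)" for n
  have w: "w n \<in> words A n" "x \<in> Is (w n)" if "n \<ge> 1" for n
    using theI'[OF word_of_regular_point[OF assms that]] by (auto simp: w_def)
  have uniq: "xs = w n" if "n \<ge> 1" "xs \<in> words A n" "x \<in> Is xs" for n xs
    using word_of_regular_point[OF assms that(1)] w[OF that(1)] that by auto
  have butlast_w: "butlast (w (Suc n)) = w n" if "n \<ge> 1" for n
  proof (rule uniq[OF that])
    show "butlast (w (Suc n)) \<in> words A n"
      using w(1)[of "Suc n"] by (auto simp: words_def dest: in_set_butlastD)
    show "x \<in> Is (butlast (w (Suc n)))"
      using w(2)[of "Suc n"] Is_subset_butlast[OF w(1)[of "Suc n"]] by auto
  qed
  \<comment> \<open>Digits are indexed from 0, so \<open>s k\<close> is the letter added in passing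
    from level k to level k + 1.\<close>
  define s where "s k = last (w (Suc k))" for k
  have map_s: "map s [0..<n] = w n" if "n \<ge> 1" for n
    using that
  proof (induction n rule: dec_induct)
    case base
    show ?case using w(1)[of 1] by (auto simp: words_def s_def length_Suc_conv)
  next
    case (step n)
    have "w (Suc n) \<noteq> []" using w(1)[of "Suc n"] by (auto simp: words_def)
    then show ?case using step butlast_w[of n] append_butlast_last_id[of "w (Suc n)"]
      by (simp add: s_def)
  qed
  show ?thesis
  proof (rule ex1I[of _ s])
    have "s k \<in> A" for k
    proof -
      have "w (Suc k) \<noteq> []" "set (w (Suc k)) \<subseteq> A" using w(1)[of "Suc k"] by (auto simp: words_def)
      then show ?thesis using last_in_set by (auto simp: s_def)
    qed
    then show "(\<forall>k. s k \<in> A) \<and> (\<forall>n\<ge>1. x \<in> Is (map s [0..<n]))"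
      using map_s w(2) by auto
  next
    fix t assume t: "(\<forall>k. t k \<in> A) \<and> (\<forall>n\<ge>1. x \<in> Is (map t [0..<n]))"
    have "map t [0..<Suc k] = map s [0..<Suc k]" for k
    proof -
      have "map t [0..<Suc k] \<in> words A (Suc k)" using t by (auto simp: words_def)
      then show ?thesis using uniq[of "Suc k" "map t [0..<Suc k]"] t map_s[of "Suc k"] by (simp del: upt_Suc)
    qed
    then have "t k = s k" for k
      using nth_map_upt[of k "Suc k" 0] by (metis add_0 diff_zero lessI)
    then show "t = s" by auto
  qed
qed

lemma
  assumes "x \<in> J"
  shows digits_in_alphabet: "digits A Is x k \<in> A"
    and digit_prefix_in_words: "digit_prefix A Is x n \<in> words A n"
    and mem_Is_digit_prefix: "x \<in> Is (digit_prefix A Is x n)"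
proof -
  have *: "(\<forall>k. digits A Is x k \<in> A) \<and> (\<forall>n\<ge>1. x \<in> Is (digit_prefix A Is x n))"
    unfolding digit_prefix_def digits_def by (rule theI'[OF ex1_digits[OF assms]])
  then show "digits A Is x k \<in> A" "digit_prefix A Is x n \<in> words A n"
    by (auto simp: words_def digit_prefix_def)
  show "x \<in> Is (digit_prefix A Is x n)"
    using * assms Is_Nil by (cases "n = 0") (auto simp: digit_prefix_def regular_points_def)
qed

text \<open>Translates digit events into membership in cells; all later computations with digits
  rest on it. At n = 0 both sides hold because \<open>J\<close> is contained in
  \<open>I\<close>.\<close>

lemma digit_prefix_eq_iff:
  assumes "x \<in> J" "xs \<in> words A n"
  shows "digit_prefix A Is x n = xs \<longleftrightarrow> x \<in> Is xs"
proof (cases "n = 0")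
  case True
  then show ?thesis using assms Is_Nil by (auto simp: digit_prefix_def words_def regular_points_def)
next
  case False
  then show ?thesis
    using word_of_regular_point[OF assms(1), of n] assms
      digit_prefix_in_words[OF assms(1), of n] mem_Is_digit_prefix[OF assms(1), of n] by auto
qed

text \<open>The target is countable and discrete, so the preimages of single words suffice; each of
  them is empty or the trace of a cell on \<open>J\<close>.\<close>

lemma measurable_digit_prefix:
  "(\<lambda>x. digit_prefix A Is x n) \<in> restrict_space borel J \<rightarrow>\<^sub>M count_space (lists A)"
proof (subst measurable_count_space_eq_countable[OF countable_lists[OF countable_alphabet]], intro conjI ballI)
  show "(\<lambda>x. digit_prefix A Is x n) \<in> space (restrict_space borel J) \<rightarrow> lists A"
    using digit_prefix_in_words by (auto simp: space_restrict_space in_words_iff)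
  fix xs assume xs: "xs \<in> lists A"
  have "(\<lambda>x. digit_prefix A Is x n) -` {xs} \<inter> space (restrict_space borel J) =
      (if length xs = n then Is xs \<inter> J else {})"
  proof (cases "length xs = n")
    case True
    then show ?thesis using xs digit_prefix_eq_iff[of _ xs n]
      by (auto simp: space_restrict_space in_words_iff)
  next
    case False
    then show ?thesis by (auto simp: digit_prefix_def)
  qed
  also have "\<dots> \<in> sets (restrict_space borel J)"
    using borel_Is[of xs n] xs borel_J by (auto simp: sets_restrict_space_iff in_words_iff)
  finally show "(\<lambda>x. digit_prefix A Is x n) -` {xs} \<inter> space (restrict_space borel J)
    \<in> sets (restrict_space borel J)" .
qed

text \<open>For n \<ge> 1 both \<open>x\<close> and \<open>y n\<close> lie in the same interval, so
  their distance is at most its length, which tends to 0 by \<open>shrink\<close>. The level 0 cell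
  need not be an interval, hence the bound is only eventual.\<close>

lemma digit_prefix_tendsto:
  assumes "x \<in> J" "\<And>n. y n \<in> Is (digit_prefix A Is x n)"
  shows "y \<longlonglongrightarrow> x"
proof -
  have lim: "(\<lambda>n. len Is (digit_prefix A Is x n)) \<longlonglongrightarrow> 0"
    unfolding len_def digit_prefix_def using digits_in_alphabet[OF assms(1)] by (intro shrink) auto
  have le: "\<forall>\<^sub>F n in sequentially. dist (y n) x \<le> len Is (digit_prefix A Is x n)"
  proof (rule eventually_sequentiallyI[of 1])
    fix n :: nat assume n: "1 \<le> n"
    have *: "x \<in> Is (digit_prefix A Is x n)" "y n \<in> Is (digit_prefix A Is x n)"
      using mem_Is_digit_prefix assms by auto
    have "Is (digit_prefix A Is x n) \<noteq> {}" using * by auto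
    note Is_eq(1)[OF digit_prefix_in_words[OF assms(1)] n this]
    from *[unfolded this[THEN eqset_imp_iff]] show "dist (y n) x \<le> len Is (digit_prefix A Is x n)"
      by (auto simp: dist_real_def)
  qed
  have "(\<lambda>n. dist (y n) x) \<longlonglongrightarrow> 0"
    by (rule tendsto_sandwich[OF _ le tendsto_const lim]) simp
  then show ?thesis by (subst tendsto_dist_iff)
qed

end

section \<open>The joint density\<close>

text \<open>The sum telescopes: \<open>c_fun\<close> is the increment of \<open>inf_fun\<close> from
  one prefix to the next, started with \<open>inf_fun\<close> at the empty word.\<close>

lemma sum_c_fun_prefixes: "(\<Sum>j\<le>length xs. c_fun Is H f (take j xs)) = inf_fun Is H f xs"
proof (induction xs rule: rev_induct)
  case Nil
  then show ?case by (simp add: c_fun_def)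
next
  case (snoc x xs)
  have "(\<Sum>j\<le>length xs. c_fun Is H f (take j (xs @ [x]))) = (\<Sum>j\<le>length xs. c_fun Is H f (take j xs))"
    by (rule sum.cong) auto
  with snoc show ?case
    by (simp add: c_fun_def[of _ _ _ "xs @ [x]"] del: take_append)
qed

locale lsc_density = nested_subdivision A I Is D
  for A :: "'d set" and I Is D +
  fixes H :: "real set" and f :: "real \<Rightarrow> real"
  assumes borel_H: "H \<in> sets borel"
    and H_subset: "H \<subseteq> J"
    and H_full: "emeasure lborel (J - H) = 0"
    and f_nonneg: "\<And>x. x \<in> J \<Longrightarrow> 0 \<le> f x"
    and lsc: "lsc_within J H f"
begin

abbreviation \<iota> where "\<iota> \<equiv> inf_fun Is H f"
abbreviation c where "c \<equiv> c_fun Is H f"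

lemma H_J: "x \<in> H \<Longrightarrow> x \<in> J"
  using H_subset by auto

lemma H_I: "H \<subseteq> I"
  using H_subset by (auto simp: regular_points_def)

text \<open>The part of \<open>I\<close> outside \<open>H\<close> lies in the union of
  \<open>J - H\<close> and the countable set of exceptional endpoints, both of measure 0.\<close>

lemma emeasure_Int_H:
  assumes "C \<in> sets borel" "C \<subseteq> I"
  shows "emeasure lborel (C \<inter> H) = emeasure lborel C"
proof -
  have "J - H \<in> null_sets lborel"
    using H_full borel_J borel_H by (simp add: null_sets_def)
  moreover have "(\<Union>n\<in>{1..}. D n) \<in> null_sets lborel"
    using null_D borel_D by (simp add: null_sets_def)
  ultimately have "(J - H) \<union> (\<Union>n\<in>{1..}. D n) \<in> null_sets lborel" by (rule null_sets.Un)
  moreover have "C - C \<inter> H \<in> sets lborel" using assms borel_H by auto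
  moreover have "C - C \<inter> H \<subseteq> (J - H) \<union> (\<Union>n\<in>{1..}. D n)"
    using assms(2) by (auto simp: regular_points_def)
  ultimately have "C - C \<inter> H \<in> null_sets lborel" by (rule null_sets_subset)
  then have "emeasure lborel (C \<inter> H \<union> (C - C \<inter> H)) = emeasure lborel (C \<inter> H)"
    using assms borel_H by (intro emeasure_Un_null_set) auto
  moreover have "C \<inter> H \<union> (C - C \<inter> H) = C" by auto
  ultimately show ?thesis by simp
qed

lemma bdd_below_f: "B \<subseteq> H \<Longrightarrow> bdd_below (f ` B)"
  using f_nonneg H_subset by (intro bdd_belowI2[of _ 0]) auto

lemma \<iota>_eq_INF:
  assumes "H \<inter> Is xs \<noteq> {}"
  shows "\<iota> xs = (INF x\<in>H \<inter> Is xs. f x)"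
proof (cases "xs = []")
  case True
  then have "H \<inter> Is xs = H" using H_I Is_Nil by auto
  then show ?thesis using True by (simp add: inf_fun_def)
qed (use assms in \<open>simp add: inf_fun_def\<close>)

text \<open>An infimum can only grow when the set shrinks and stays non-empty. If the cell missed
  \<open>H\<close>, the convention would make \<open>\<iota> xs\<close> equal to 0, and
  \<open>c xs\<close> could be negative.\<close>

lemma c_nonneg:
  assumes "xs \<in> words A n" "H \<inter> Is xs \<noteq> {}"
  shows "0 \<le> c xs"
proof (cases "xs = []")
  case True
  have "0 \<le> (INF x\<in>H \<inter> Is xs. f x)"
    using assms(2) f_nonneg H_subset by (intro cINF_greatest) auto
  then show ?thesis using True \<iota>_eq_INF[OF assms(2)] by (simp add: c_fun_def)
next
  case False
  have sub: "H \<inter> Is xs \<subseteq> H \<inter> Is (butlast xs)"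
    using Is_subset_butlast[OF assms(1)] by auto
  then have ne: "H \<inter> Is (butlast xs) \<noteq> {}" using assms(2) by auto
  have "(INF x\<in>H \<inter> Is (butlast xs). f x) \<le> (INF x\<in>H \<inter> Is xs. f x)"
    using sub assms(2) bdd_below_f by (intro cINF_superset_mono) auto
  then show ?thesis using False by (simp add: c_fun_def \<iota>_eq_INF[OF ne] \<iota>_eq_INF[OF assms(2)])
qed

lemma c_digit_prefix_nonneg: "x \<in> H \<Longrightarrow> 0 \<le> c (digit_prefix A Is x n)"
  using c_nonneg[OF digit_prefix_in_words] mem_Is_digit_prefix H_J by blast

lemma sum_c_digit_prefix: "(\<Sum>j\<le>n. c (digit_prefix A Is x j)) = \<iota> (digit_prefix A Is x n)"
proof -
  have "(\<Sum>j\<le>n. c (digit_prefix A Is x j)) = (\<Sum>j\<le>n. c (take j (digit_prefix A Is x n)))"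
    by (rule sum.cong) (auto simp: digit_prefix_def take_map)
  then show ?thesis
    using sum_c_fun_prefixes[of Is H f "digit_prefix A Is x n"] by (simp add: digit_prefix_def)
qed

text \<open>The infima never exceed \<open>f x\<close>, since \<open>x\<close> lies in every cell of
  its digits. Conversely, points of \<open>H\<close> that nearly attain them converge to
  \<open>x\<close>, so lower semi-continuity keeps their values from staying below
  \<open>f x\<close>.\<close>

lemma \<iota>_digit_prefix_tendsto:
  assumes x: "x \<in> H"
  shows "(\<lambda>n. \<iota> (digit_prefix A Is x n)) \<longlonglongrightarrow> f x"
proof -
  define K where "K n = H \<inter> Is (digit_prefix A Is x n)" for n
  have xK: "x \<in> K n" for n
    using x mem_Is_digit_prefix[OF H_J[OF x]] by (auto simp: K_def)
  have \<iota>: "\<iota> (digit_prefix A Is x n) = (INF x\<in>K n. f x)" for n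
    using \<iota>_eq_INF[of "digit_prefix A Is x n"] xK by (auto simp: K_def)
  have le: "(INF x\<in>K n. f x) \<le> f x" for n
    using xK bdd_below_f by (intro cINF_lower) (auto simp: K_def)
  have "\<exists>y\<in>K n. f y < (INF x\<in>K n. f x) + 1 / real (Suc n)" for n
  proof -
    have "Inf (f ` K n) < (INF x\<in>K n. f x) + 1 / real (Suc n)" by simp
    then show ?thesis using xK[of n] cInf_lessD[of "f ` K n"] by blast
  qed
  then obtain y where y: "\<And>n. y n \<in> K n" "\<And>n. f (y n) < (INF x\<in>K n. f x) + 1 / real (Suc n)"
    by metis
  have "y \<longlonglongrightarrow> x"
    using y(1) by (intro digit_prefix_tendsto H_J x) (auto simp: K_def)
  moreover have "y n \<in> J" for n using y(1)[of n] H_J by (auto simp: K_def)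
  ultimately have lim: "ereal (f x) \<le> liminf (\<lambda>n. ereal (f (y n)))"
    using lsc x unfolding lsc_within_def by blast
  show ?thesis unfolding \<iota>
  proof (rule order_tendstoI)
    fix a assume a: "a < f x"
    \<comment> \<open>Half of the gap pays for the limit inferior, the other half for the error 1/(n
      + 1) in the choice of \<open>y n\<close>.\<close>
    define d where "d = (f x - a) / 2"
    have d: "0 < d" using a by (simp add: d_def)
    have "ereal (f x - d) < liminf (\<lambda>n. ereal (f (y n)))"
      using d by (intro order_less_le_trans[OF _ lim]) simp
    then have "\<forall>\<^sub>F n in sequentially. ereal (f x - d) < ereal (f (y n))" by (rule less_LiminfD)
    moreover have "\<forall>\<^sub>F n in sequentially. 1 / real (Suc n) < d"
      using order_tendstoD(2)[OF LIMSEQ_inverse_real_of_nat d] by (simp add: inverse_eq_divide)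
    ultimately show "\<forall>\<^sub>F n in sequentially. a < (INF x\<in>K n. f x)"
    proof eventually_elim
      case (elim n)
      then have "f x - d < (INF x\<in>K n. f x) + d" using y(2)[of n] by simp
      then show ?case by (simp add: d_def field_simps)
    qed
  next
    fix a assume "f x < a"
    then show "\<forall>\<^sub>F n in sequentially. (INF x\<in>K n. f x) < a"
      using le order_le_less_trans by (intro always_eventually) blast
  qed
qed

lemma c_digit_prefix_sums: "x \<in> H \<Longrightarrow> (\<lambda>n. c (digit_prefix A Is x n)) sums f x"
  unfolding sums_def_le sum_c_digit_prefix by (rule \<iota>_digit_prefix_tendsto)

lemma joint_density_nonneg: "0 \<le> joint_density A Is H f x n"
  using c_digit_prefix_nonneg by (simp add: joint_density_def)

lemma sets_ref_measure: "sets (ref_measure H) = sets (borel \<Otimes>\<^sub>M count_space UNIV)"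
  unfolding ref_measure_def by (intro sets_pair_measure_cong) auto

lemma space_ref_measure: "space (ref_measure H) = UNIV"
  by (simp add: ref_measure_def space_pair_measure)

text \<open>For fixed n this is a function on a countable discrete space composed with the digit
  prefix; the countably many n are then glued together.\<close>

lemma measurable_joint_density:
  "(\<lambda>(x, n). ennreal (joint_density A Is H f x n)) \<in> borel_measurable (ref_measure H)"
proof -
  have [measurable]: "(\<lambda>x. joint_density A Is H f x n) \<in> borel_measurable borel" for n
  proof -
    have "(\<lambda>x. digit_prefix A Is x n) \<in> restrict_space borel H \<rightarrow>\<^sub>M count_space (lists A)"
      by (rule measurable_restrict_mono[OF measurable_digit_prefix H_subset])
    from measurable_compose[OF this, of c borel]
    have "(\<lambda>x. c (digit_prefix A Is x n)) \<in> borel_measurable (restrict_space borel {x. x \<in> H})" by simp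
    then show ?thesis
      unfolding joint_density_def using borel_H by (subst measurable_If_restrict_space_iff) auto
  qed
  have "(\<lambda>p. joint_density A Is H f (fst p) (snd p)) \<in> borel_measurable (borel \<Otimes>\<^sub>M count_space UNIV)"
    by (rule measurable_compose_countable[OF _ measurable_snd]) measurable
  then show ?thesis
    by (simp add: case_prod_beta' measurable_cong_sets[OF sets_ref_measure refl])
qed

lemma nn_integral_ref_measure:
  assumes "F \<in> borel_measurable (ref_measure H)"
  shows "(\<integral>\<^sup>+p. F p \<partial>ref_measure H) = (\<integral>\<^sup>+x. (\<Sum>k. F (x, k)) * indicator H x \<partial>lborel)"
proof -
  interpret count: sigma_finite_measure "count_space (UNIV :: nat set)"
    by (rule sigma_finite_measure_count_space)
  have [measurable]: "F \<in> borel_measurable (lborel \<Otimes>\<^sub>M count_space UNIV)"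
    using assms sets_ref_measure by (simp cong: measurable_cong_sets)
  have "(\<integral>\<^sup>+p. F p \<partial>ref_measure H) =
      (\<integral>\<^sup>+x. \<integral>\<^sup>+k. F (x, k) \<partial>count_space UNIV \<partial>density lborel (indicator H))"
    using assms unfolding ref_measure_def by (intro count.nn_integral_fst[symmetric])
  also have "\<dots> = (\<integral>\<^sup>+x. indicator H x * (\<integral>\<^sup>+k. F (x, k) \<partial>count_space UNIV) \<partial>lborel)"
    using borel_H by (intro nn_integral_density count.borel_measurable_nn_integral_fst) auto
  finally show ?thesis by (simp add: nn_integral_count_space_nat mult.commute)
qed

end

section \<open>Laws under a coupling\<close>

text \<open>Only the joint law of \<open>X\<close> and \<open>N\<close> is assumed, so the results
  apply to every coupling. \<open>E0\<close> enters in an extension of this locale, because the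
  existence proof needs facts about \<open>S\<close> before it can establish
  \<open>auxiliary_E0\<close>.\<close>

locale digit_coupling = lsc_density A I Is D H f + prob_space M
  for A :: "'d set" and I Is D H f and M :: "'b measure" +
  fixes X :: "'b \<Rightarrow> real" and N :: "'b \<Rightarrow> nat"
  assumes measurable_X: "X \<in> M \<rightarrow>\<^sub>M restrict_space lborel J"
    and measurable_N: "N \<in> M \<rightarrow>\<^sub>M count_space UNIV"
    and joint_law: "distributed M (ref_measure H) (\<lambda>\<omega>. (X \<omega>, N \<omega>))
      (\<lambda>(x, n). ennreal (joint_density A Is H f x n))"
begin

abbreviation S where "S \<equiv> S_of A Is X N"
abbreviation L where "L \<equiv> L_of A Is X N"

lemma X_in_J: "\<omega> \<in> space M \<Longrightarrow> X \<omega> \<in> J"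
  using measurable_space[OF measurable_X] by (simp add: space_restrict_space)

lemma measurable_X': "X \<in> M \<rightarrow>\<^sub>M restrict_space borel J"
  using measurable_X
  by (simp only: measurable_cong_sets[OF refl sets_restrict_space_cong[OF sets_lborel]])

lemma borel_measurable_X[measurable]: "X \<in> borel_measurable M"
  using measurable_X' borel_J by (simp add: measurable_restrict_space2_iff)

lemma measurable_S: "S \<in> M \<rightarrow>\<^sub>M count_space (lists A)"
  unfolding S_of_def
  by (rule measurable_compose_countable[OF measurable_compose[OF measurable_X' measurable_digit_prefix] measurable_N])

text \<open>Points of \<open>C \<inter> H\<close> all have the digit prefix \<open>xs\<close> at
  level n, so the joint density is the constant \<open>c xs\<close> there, and replacing
  \<open>C \<inter> H\<close> by \<open>C\<close> does not change the measure.\<close>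

lemma emeasure_X_N:
  assumes xs: "xs \<in> words A n" and C: "C \<in> sets borel" "C \<subseteq> Is xs"
  shows "emeasure M {\<omega> \<in> space M. X \<omega> \<in> C \<and> N \<omega> = n} = ennreal (c xs) * emeasure lborel C"
proof -
  have Cn: "C \<times> {n} \<in> sets (ref_measure H)"
    unfolding sets_ref_measure using C by auto
  \<comment> \<open>Only the term k = n of the series survives.\<close>
  have val: "(\<Sum>k. ennreal (joint_density A Is H f x k) * indicator (C \<times> {n}) (x, k)) * indicator H x =
      ennreal (c xs) * indicator (C \<inter> H) x" for x
  proof (cases "x \<in> C \<inter> H")
    case True
    then have "digit_prefix A Is x n = xs"
      using C digit_prefix_eq_iff[OF H_J xs] by auto
    then show ?thesis
      using True by (subst suminf_finite[of "{n}"]) (auto simp: joint_density_def)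
  next
    case False
    then show ?thesis by (auto simp: indicator_def)
  qed
  have "emeasure M {\<omega> \<in> space M. X \<omega> \<in> C \<and> N \<omega> = n} =
      emeasure M ((\<lambda>\<omega>. (X \<omega>, N \<omega>)) -` (C \<times> {n}) \<inter> space M)"
    by (rule arg_cong[of _ _ "emeasure M"]) auto
  also have "\<dots> = (\<integral>\<^sup>+p. (case p of (x, n) \<Rightarrow> ennreal (joint_density A Is H f x n)) * indicator (C \<times> {n}) p \<partial>ref_measure H)"
    by (rule distributed_emeasure[OF joint_law Cn])
  also have "\<dots> = (\<integral>\<^sup>+x. ennreal (c xs) * indicator (C \<inter> H) x \<partial>lborel)"
    using measurable_joint_density Cn by (subst nn_integral_ref_measure) (auto simp: val)
  also have "\<dots> = ennreal (c xs) * emeasure lborel (C \<inter> H)"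
    using C borel_H by (intro nn_integral_cmult_indicator) auto
  finally show ?thesis
    using emeasure_Int_H C Is_subset_I[OF xs] by auto
qed

lemma measurable_X_N:
  assumes [measurable]: "C \<in> sets borel"
  shows "{\<omega> \<in> space M. X \<omega> \<in> C \<and> N \<omega> = n} \<in> events"
    and "{\<omega> \<in> space M. X \<omega> \<in> C \<and> N \<omega> \<le> n} \<in> events"
proof -
  note measurable_N[measurable]
  show "{\<omega> \<in> space M. X \<omega> \<in> C \<and> N \<omega> = n} \<in> events" by measurable
  show "{\<omega> \<in> space M. X \<omega> \<in> C \<and> N \<omega> \<le> n} \<in> events" by measurable
qed

lemma prob_X_N:
  assumes xs: "xs \<in> words A n" and C: "C \<in> sets borel" "C \<subseteq> Is xs"
  shows "\<P>(\<omega> in M. X \<omega> \<in> C \<and> N \<omega> = n) = c xs * measure lborel C"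
\<comment> \<open>\<open>ennreal\<close> truncates negative numbers to 0, so the passage to reals
  needs a sign. A cell that misses \<open>H\<close> makes \<open>C\<close> null, whatever the sign
  of \<open>c xs\<close>; any other cell has \<open>c xs \<ge> 0\<close>.\<close>
proof (cases "H \<inter> Is xs = {}")
  case True
  then have "C \<inter> H = {}" using C by auto
  then have "emeasure lborel C = 0" using emeasure_Int_H[of C] C Is_subset_I[OF xs] by auto
  then show ?thesis using emeasure_X_N[OF assms] by (simp add: measure_def)
next
  case False
  then show ?thesis using emeasure_X_N[OF assms] c_nonneg[OF xs False]
    by (simp add: measure_def enn2real_mult)
qed

text \<open>By nesting, \<open>C\<close> also lies in the cell of each prefix of \<open>xs\<close>,
  so the event N = j contributes \<open>c (take j xs)\<close> times the measure of \<open>C\<close>;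
  these factors telescope to \<open>\<iota> xs\<close>.\<close>

lemma prob_X_N_le:
  assumes xs: "xs \<in> words A n" and C: "C \<in> sets borel" "C \<subseteq> Is xs"
  shows "\<P>(\<omega> in M. X \<omega> \<in> C \<and> N \<omega> \<le> n) = \<iota> xs * measure lborel C"
proof -
  have len: "length xs = n" using xs by (simp add: words_def)
  have "{\<omega> \<in> space M. X \<omega> \<in> C \<and> N \<omega> \<le> n} = (\<Union>j\<le>n. {\<omega> \<in> space M. X \<omega> \<in> C \<and> N \<omega> = j})" by auto
  then have "\<P>(\<omega> in M. X \<omega> \<in> C \<and> N \<omega> \<le> n) = (\<Sum>j\<le>n. \<P>(\<omega> in M. X \<omega> \<in> C \<and> N \<omega> = j))"
    using measurable_X_N[OF C(1)]
    by (simp only:) (intro finite_measure_finite_Union, auto simp: disjoint_family_on_def)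
  also have "\<dots> = (\<Sum>j\<le>n. c (take j xs) * measure lborel C)"
  proof (intro sum.cong refl prob_X_N C(1))
    fix j assume "j \<in> {..n}"
    then show "take j xs \<in> words A j" using xs by (auto simp: words_def dest: in_set_takeD)
    show "C \<subseteq> Is (take j xs)"
      using Is_subset_prefix[of "take j xs" "drop j xs"] xs C(2) by (auto simp: in_words_iff)
  qed
  also have "\<dots> = \<iota> xs * measure lborel C"
    using sum_c_fun_prefixes[of Is H f xs] by (simp add: len flip: sum_distrib_right)
  finally show ?thesis .
qed

text \<open>The length of \<open>S\<close> is \<open>N\<close>, so the value of \<open>S\<close>
  fixes both the level and the cell.\<close>

lemma S_eq_iff:
  assumes "\<omega> \<in> space M" "xs \<in> words A n"
  shows "S \<omega> = xs \<longleftrightarrow> X \<omega> \<in> Is xs \<and> N \<omega> = n"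
proof -
  have "S \<omega> = xs \<Longrightarrow> N \<omega> = n"
    using assms(2) by (auto simp: words_def S_of_def digit_prefix_def)
  then show ?thesis
    using digit_prefix_eq_iff[OF X_in_J[OF assms(1)] assms(2)] by (auto simp: S_of_def)
qed

lemma S_eq_Nil_iff: "S \<omega> = [] \<longleftrightarrow> N \<omega> = 0"
  by (auto simp: S_of_def digit_prefix_def)

lemma prob_S:
  assumes xs: "xs \<in> words A n"
  shows "\<P>(\<omega> in M. S \<omega> = xs) = c xs * len Is xs"
proof -
  have "{\<omega> \<in> space M. S \<omega> = xs} = {\<omega> \<in> space M. X \<omega> \<in> Is xs \<and> N \<omega> = n}"
    using S_eq_iff[OF _ xs] by blast
  then show ?thesis using prob_X_N[OF xs borel_Is[OF xs] order_refl] by (simp only: len_def)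
qed

text \<open>The event N \<le> n is cut according to the level-n cell that contains \<open>X\<close>,
  even where \<open>N\<close> is smaller than n.\<close>

lemma has_sum_prob_N_le: "((\<lambda>xs. \<iota> xs * len Is xs) has_sum \<P>(\<omega> in M. N \<omega> \<le> n)) (words A n)"
proof -
  define F where "F xs = {\<omega> \<in> space M. X \<omega> \<in> Is xs \<and> N \<omega> \<le> n}" for xs
  have "F xs \<in> events" if "xs \<in> words A n" for xs
    unfolding F_def by (rule measurable_X_N(2)[OF borel_Is[OF that]])
  moreover have "disjoint_family_on F (words A n)"
    unfolding disjoint_family_on_def
  proof (intro ballI impI)
    fix xs ys assume *: "xs \<in> words A n" "ys \<in> words A n" "xs \<noteq> ys"
    have "digit_prefix A Is (X \<omega>) n = xs \<and> digit_prefix A Is (X \<omega>) n = ys"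
      if "\<omega> \<in> F xs \<inter> F ys" for \<omega>
      using that digit_prefix_eq_iff[OF X_in_J *(1)] digit_prefix_eq_iff[OF X_in_J *(2)]
      by (auto simp: F_def)
    then show "F xs \<inter> F ys = {}" using *(3) by blast
  qed
  ultimately have "((\<lambda>xs. prob (F xs)) has_sum prob (\<Union>xs\<in>words A n. F xs)) (words A n)"
    by (rule has_sum_measure_UN[OF countable_words])
  moreover have "(\<Union>xs\<in>words A n. F xs) = {\<omega> \<in> space M. N \<omega> \<le> n}"
    using mem_Is_digit_prefix[OF X_in_J]
    by (auto simp: F_def intro!: bexI[OF _ digit_prefix_in_words[OF X_in_J]])
  moreover have "prob (F xs) = \<iota> xs * len Is xs" if "xs \<in> words A n" for xs
    using prob_X_N_le[OF that borel_Is[OF that]] by (simp add: F_def len_def)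
  ultimately show ?thesis
    using has_sum_cong[of "words A n" "\<lambda>xs. prob (F xs)" "\<lambda>xs. \<iota> xs * len Is xs"] by metis
qed

text \<open>The event that \<open>S\<close> is \<open>xs\<close> and \<open>R\<close> starts with
  \<open>ys\<close> places \<open>X\<close> in the cell of \<open>xs @ ys\<close> while
  \<open>N\<close> remains n. Its density is therefore still \<open>c xs\<close>, which cancels in
  the quotient.\<close>

lemma cond_prob_R:
  assumes xs: "xs \<in> words A n" and ys: "ys \<in> words A m" and pos: "\<P>(\<omega> in M. S \<omega> = xs) > 0"
  shows "\<P>(\<omega> in M. (\<forall>k<m. R_of A Is X N \<omega> k = ys ! k) \<bar> S \<omega> = xs) = len Is (xs @ ys) / len Is xs"
proof -
  have xys: "xs @ ys \<in> words A (n + m)" using xs ys by (auto simp: words_def)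
  have "((\<forall>k<m. R_of A Is X N \<omega> k = ys ! k) \<and> S \<omega> = xs) \<longleftrightarrow> X \<omega> \<in> Is (xs @ ys) \<and> N \<omega> = n"
    if \<omega>: "\<omega> \<in> space M" for \<omega>
  proof -
    have l: "length xs = n" "length ys = m" using xs ys by (auto simp: words_def)
    have "X \<omega> \<in> Is (xs @ ys) \<longleftrightarrow> digit_prefix A Is (X \<omega>) (n + m) = xs @ ys"
      using digit_prefix_eq_iff[OF X_in_J[OF \<omega>] xys] by simp
    also have "\<dots> \<longleftrightarrow> digit_prefix A Is (X \<omega>) n = xs \<and> (\<forall>k<m. digits A Is (X \<omega>) (n + k) = ys ! k)"
      unfolding digit_prefix_add using l
      by (subst append_eq_append_conv) (auto simp: digit_prefix_def list_eq_iff_nth_eq)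
    finally have "X \<omega> \<in> Is (xs @ ys) \<longleftrightarrow>
      digit_prefix A Is (X \<omega>) n = xs \<and> (\<forall>k<m. digits A Is (X \<omega>) (n + k) = ys ! k)" .
    moreover have "S \<omega> = xs \<longleftrightarrow> digit_prefix A Is (X \<omega>) n = xs \<and> N \<omega> = n"
      using S_eq_iff[OF \<omega> xs] digit_prefix_eq_iff[OF X_in_J[OF \<omega>] xs] by simp
    ultimately show ?thesis by (auto simp: R_of_def)
  qed
  then have "\<P>(\<omega> in M. (\<forall>k<m. R_of A Is X N \<omega> k = ys ! k) \<and> S \<omega> = xs) =
      \<P>(\<omega> in M. X \<omega> \<in> Is (xs @ ys) \<and> N \<omega> = n)"
    by (simp cong: conj_cong)
  also have "\<dots> = c xs * len Is (xs @ ys)"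
    unfolding len_def using xs ys borel_Is[OF xys] Is_subset_prefix[of xs ys]
    by (intro prob_X_N) (auto simp: in_words_iff)
  finally have *: "\<P>(\<omega> in M. (\<forall>k<m. R_of A Is X N \<omega> k = ys ! k) \<and> S \<omega> = xs) = c xs * len Is (xs @ ys)" .
  have "c xs \<noteq> 0" using pos prob_S[OF xs] by auto
  then show ?thesis
    by (simp add: cond_prob_def * prob_S[OF xs])
qed

lemma sets_S: "xs \<in> lists A \<Longrightarrow> {\<omega> \<in> space M. S \<omega> = xs} \<in> events"
  using measurable_sets[OF measurable_S, of "{xs}"] by (simp add: vimage_def Int_def conj_commute)

lemma measurable_L[measurable]: "L \<in> borel_measurable M"
  using measurable_compose[OF measurable_S, of "len Is" borel] by (simp add: L_of_def[abs_def])

text \<open>Some cells may be empty, so \<open>L\<close> could a priori be 0. But a word whose cell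
  has length 0 is a value of \<open>S\<close> with probability 0, and there are only countably many
  words. Positivity of \<open>l\<close> makes the uniform law on (0, l) a probability
  measure.\<close>

lemma L_pos:
  assumes "\<P>(\<omega> in M. L \<omega> = l) > 0"
  shows "0 < l"
proof (rule ccontr)
  assume l: "\<not> 0 < l"
  have "{\<omega> \<in> space M. S \<omega> = xs} \<in> null_sets M" if "xs \<in> lists A" "len Is xs \<le> 0" for xs
  proof -
    have "len Is xs = 0" using that(2) by (simp add: len_def measure_le_0_iff)
    then have "prob {\<omega> \<in> space M. S \<omega> = xs} = 0"
      using prob_S[of xs "length xs"] that(1) by (simp add: in_words_iff)
    then show ?thesis using sets_S[OF that(1)] by (simp add: null_sets_def emeasure_eq_measure)
  qed
  then have "(\<Union>xs\<in>{xs \<in> lists A. len Is xs \<le> 0}. {\<omega> \<in> space M. S \<omega> = xs}) \<in> null_sets M"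
    by (intro null_sets_UN' countable_subset[OF _ countable_lists[OF countable_alphabet]]) auto
  moreover have "{\<omega> \<in> space M. L \<omega> = l} \<in> events" by measurable
  moreover have "{\<omega> \<in> space M. L \<omega> = l} \<subseteq> (\<Union>xs\<in>{xs \<in> lists A. len Is xs \<le> 0}. {\<omega> \<in> space M. S \<omega> = xs})"
    using l measurable_space[OF measurable_S] by (auto simp: L_of_def)
  ultimately have "{\<omega> \<in> space M. L \<omega> = l} \<in> null_sets M"
    by (rule null_sets_subset)
  then have "\<P>(\<omega> in M. L \<omega> = l) = 0" by (rule measure_eq_0_null_sets)
  then show False using assms by simp
qed

end

section \<open>The laws of E and U given S or L\<close>

locale digit_coupling_E0 = digit_coupling A I Is D H f M X N
  for A :: "'d set" and I Is D H f and M :: "'b measure" and X N +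
  fixes E0 :: "'b \<Rightarrow> real"
  assumes E0: "auxiliary_E0 A Is M X N E0"
begin

abbreviation E where "E \<equiv> E_of A Is X N E0"
abbreviation U where "U \<equiv> U_of A Is X N E0"
abbreviation unif :: "real \<Rightarrow> real measure" where "unif l \<equiv> uniform_measure lborel {0<..<l}"

lemma measurable_E0[measurable]: "E0 \<in> borel_measurable M"
  using E0 by (simp add: auxiliary_E0_def)

lemma measurable_E[measurable]: "E \<in> borel_measurable M"
proof -
  have [measurable]: "(\<lambda>\<omega>. left_end Is (S \<omega>)) \<in> borel_measurable M"
    using measurable_compose[OF measurable_S, of "left_end Is" borel] by simp
  note measurable_N[measurable]
  have "(\<lambda>\<omega>. if N \<omega> = 0 then E0 \<omega> else X \<omega> - left_end Is (S \<omega>)) \<in> borel_measurable M"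
    by measurable
  moreover have "E = (\<lambda>\<omega>. if N \<omega> = 0 then E0 \<omega> else X \<omega> - left_end Is (S \<omega>))"
    by (simp add: fun_eq_iff E_of_def S_of_def)
  ultimately show ?thesis by simp
qed

lemma measurable_U[measurable]: "U \<in> borel_measurable M"
  unfolding U_of_def[abs_def] by measurable

text \<open>Removes the conditioning from the requirement on \<open>E0\<close>, so that the empty
  word obeys a product formula of the same kind as the other words.\<close>

lemma prob_N_0_E0:
  assumes "B \<in> sets borel" "\<P>(\<omega> in M. N \<omega> = 0) > 0"
  shows "\<P>(\<omega> in M. N \<omega> = 0 \<and> E0 \<omega> \<in> B) = \<P>(\<omega> in M. N \<omega> = 0) * measure (unif (len Is [])) B"
proof -
  note measurable_N[measurable]
  let ?G = "given M (\<lambda>\<omega>. N \<omega> = 0)"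
  have "distr ?G lborel E0 = unif (len Is [])" "E0 \<in> ?G \<rightarrow>\<^sub>M lborel"
    using E0 assms(2) by (auto simp: auxiliary_E0_def has_unif_law_def)
  then have "measure (unif (len Is [])) B = measure ?G (E0 -` B \<inter> space ?G)"
    using assms(1) by (metis measure_distr sets_lborel)
  also have "\<dots> = \<P>(\<omega> in ?G. E0 \<omega> \<in> B)"
    by (rule arg_cong[of _ _ "measure ?G"]) auto
  also have "\<dots> = \<P>(\<omega> in M. N \<omega> = 0 \<and> E0 \<omega> \<in> B) / \<P>(\<omega> in M. N \<omega> = 0)"
    using assms by (intro measure_given) auto
  finally show ?thesis using assms(2) by simp
qed

text \<open>For the empty word this is the requirement on \<open>E0\<close>. For any other word,
  \<open>X\<close> has constant density on an interval, and subtracting the left endpoint moves that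
  interval to (0, \<open>len Is xs\<close>).\<close>

lemma prob_S_E:
  assumes xs: "xs \<in> lists A" and B: "B \<in> sets borel"
  shows "\<P>(\<omega> in M. S \<omega> = xs \<and> E \<omega> \<in> B) = \<P>(\<omega> in M. S \<omega> = xs) * measure (unif (len Is xs)) B"
\<comment> \<open>Words with cells of length 0 end up in the null case, where both sides vanish
  whatever \<open>unif\<close> means at 0.\<close>
proof (cases "\<P>(\<omega> in M. S \<omega> = xs) = 0")
  case True
  have "\<P>(\<omega> in M. S \<omega> = xs \<and> E \<omega> \<in> B) \<le> \<P>(\<omega> in M. S \<omega> = xs)"
    using sets_S[OF xs] by (intro finite_measure_mono) auto
  then show ?thesis using True by (simp add: measure_le_0_iff)
next
  case False
  then have pos: "\<P>(\<omega> in M. S \<omega> = xs) > 0" by (simp add: zero_less_measure_iff)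
  show ?thesis
  proof (cases "xs = []")
    case True
    have "(S \<omega> = [] \<and> E \<omega> \<in> B) \<longleftrightarrow> N \<omega> = 0 \<and> E0 \<omega> \<in> B" for \<omega>
      by (auto simp: S_eq_Nil_iff E_of_def)
    then show ?thesis
      using prob_N_0_E0[OF B] pos by (simp add: True S_eq_Nil_iff)
  next
    case False
    define n a l where "n = length xs" and "a = left_end Is xs" and "l = len Is xs"
    have w: "xs \<in> words A n" and n: "n \<ge> 1" using xs False by (auto simp: in_words_iff n_def Suc_le_eq)
    have prob: "\<P>(\<omega> in M. S \<omega> = xs) = c xs * l" using prob_S[OF w] by (simp add: l_def)
    then have "Is xs \<noteq> {}" using pos by (auto simp: l_def len_def)
    note I = Is_eq[OF w n this, folded a_def l_def]
    have C: "Is xs \<inter> {x. x - a \<in> B} \<in> sets borel"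
    proof -
      have "{x. x - a \<in> B} \<in> sets borel" using B by measurable
      then show ?thesis using borel_Is[OF w] by auto
    qed
    have "(S \<omega> = xs \<and> E \<omega> \<in> B) \<longleftrightarrow> X \<omega> \<in> Is xs \<inter> {x. x - a \<in> B} \<and> N \<omega> = n"
      if \<omega>: "\<omega> \<in> space M" for \<omega>
    proof -
      have "E \<omega> = X \<omega> - a" if "S \<omega> = xs"
        using that False S_eq_Nil_iff[of \<omega>] by (auto simp: E_of_def S_of_def a_def)
      then show ?thesis using S_eq_iff[OF \<omega> w] by auto
    qed
    then have "\<P>(\<omega> in M. S \<omega> = xs \<and> E \<omega> \<in> B) = \<P>(\<omega> in M. X \<omega> \<in> Is xs \<inter> {x. x - a \<in> B} \<and> N \<omega> = n)"
      by (simp cong: conj_cong)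
    also have "\<dots> = c xs * measure lborel (Is xs \<inter> {x. x - a \<in> B})"
      using w C by (rule prob_X_N) auto
    also have "measure lborel (Is xs \<inter> {x. x - a \<in> B}) = measure lborel {x. a + x \<in> Is xs \<inter> {x. x - a \<in> B}}"
      using C by (rule measure_lborel_translate[symmetric])
    also have "{x. a + x \<in> Is xs \<inter> {x. x - a \<in> B}} = {0<..<l} \<inter> B"
      using I(1) by auto
    finally show ?thesis
      using measure_uniform_interval[OF I(2) B] I(2) prob by (simp add: l_def)
  qed
qed

text \<open>On the event that \<open>S\<close> is \<open>xs\<close>, U is E divided by the constant
  \<open>len Is xs\<close>. Scaling turns each law \<open>unif (len Is xs)\<close> into
  \<open>unif 1\<close>, which no longer depends on the word.\<close>

lemma prob_S_U:
  assumes xs: "xs \<in> lists A" and B: "B \<in> sets borel"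
  shows "\<P>(\<omega> in M. S \<omega> = xs \<and> U \<omega> \<in> B) = \<P>(\<omega> in M. S \<omega> = xs) * measure (unif 1) B"
proof (cases "\<P>(\<omega> in M. S \<omega> = xs) = 0")
  case True
  have "\<P>(\<omega> in M. S \<omega> = xs \<and> U \<omega> \<in> B) \<le> \<P>(\<omega> in M. S \<omega> = xs)"
    using sets_S[OF xs] by (intro finite_measure_mono) auto
  then show ?thesis using True by (simp add: measure_le_0_iff)
next
  case False
  have "len Is xs \<noteq> 0"
    using False prob_S[of xs "length xs"] xs by (auto simp: in_words_iff)
  then have l: "0 < len Is xs" by (simp add: len_def zero_less_measure_iff)
  have "(S \<omega> = xs \<and> U \<omega> \<in> B) \<longleftrightarrow> S \<omega> = xs \<and> E \<omega> \<in> {e. e / len Is xs \<in> B}" for \<omega>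
    by (auto simp: U_of_def L_of_def)
  moreover have "{e. e / len Is xs \<in> B} \<in> sets borel" using B by measurable
  ultimately show ?thesis
    using prob_S_E[OF xs, of "{e. e / len Is xs \<in> B}"] measure_uniform_interval_scale[OF l B] by simp
qed

lemma indep_S_U: "indep_rv M (count_space (lists A)) S borel U"
  and law_U: "has_unif_law M U 1"
proof -
  note * = indep_rv_and_law_of_countable[OF prob_space_axioms countable_lists[OF countable_alphabet]
      measurable_S measurable_U prob_space_uniform_interval[of 1] _ prob_S_U]
  show "indep_rv M (count_space (lists A)) S borel U" by (rule *(1)) auto
  have "distr M lborel U = unif 1" by (rule *(2)) auto
  then show "has_unif_law M U 1" by (simp add: has_unif_law_def)
qed

lemma
  assumes l: "\<P>(\<omega> in M. L \<omega> = l) > 0"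
  shows indep_S_E_given_L: "indep_rv (given M (\<lambda>\<omega>. L \<omega> = l)) (count_space (lists A)) S borel E"
    and law_E_given_L: "has_unif_law (given M (\<lambda>\<omega>. L \<omega> = l)) E l"
proof -
  have eq: "\<P>(\<omega> in M. L \<omega> = l \<and> S \<omega> = xs \<and> E \<omega> \<in> B) =
      \<P>(\<omega> in M. L \<omega> = l \<and> S \<omega> = xs) * measure (unif l) B"
    if "xs \<in> lists A" "B \<in> sets borel" for xs B
  \<comment> \<open>\<open>L\<close> is a function of \<open>S\<close>: the event that
    \<open>S\<close> is \<open>xs\<close> is either contained in the event that \<open>L\<close> is
    \<open>l\<close> or disjoint from it.\<close>
  proof (cases "len Is xs = l")
    case True
    then have "{\<omega> \<in> space M. L \<omega> = l \<and> S \<omega> = xs \<and> E \<omega> \<in> B} = {\<omega> \<in> space M. S \<omega> = xs \<and> E \<omega> \<in> B}"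
        "{\<omega> \<in> space M. L \<omega> = l \<and> S \<omega> = xs} = {\<omega> \<in> space M. S \<omega> = xs}"
      by (auto simp: L_of_def)
    then show ?thesis using prob_S_E[OF that] True by simp
  next
    case False
    then have "\<not> (L \<omega> = l \<and> S \<omega> = xs)" for \<omega>
      by (auto simp: L_of_def)
    then have "{\<omega> \<in> space M. L \<omega> = l \<and> S \<omega> = xs \<and> E \<omega> \<in> B} = {}" "{\<omega> \<in> space M. L \<omega> = l \<and> S \<omega> = xs} = {}"
      by auto
    then show ?thesis by (simp only: measure_empty mult_zero_left)
  qed
  have "{\<omega> \<in> space M. L \<omega> = l} \<in> events" by measurable
  note * = indep_rv_and_law_given[OF prob_space_axioms countable_lists[OF countable_alphabet]
      measurable_S measurable_E this l prob_space_uniform_interval[OF L_pos[OF l]] _ eq]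
  show "indep_rv (given M (\<lambda>\<omega>. L \<omega> = l)) (count_space (lists A)) S borel E"
    by (rule *(1)) auto
  then have "E \<in> borel_measurable (given M (\<lambda>\<omega>. L \<omega> = l))"
    by (simp add: indep_rv_def)
  moreover have "distr (given M (\<lambda>\<omega>. L \<omega> = l)) lborel E = unif l"
    by (rule *(2)) auto
  ultimately show "has_unif_law (given M (\<lambda>\<omega>. L \<omega> = l)) E l"
    by (simp add: has_unif_law_def)
qed

end

section \<open>Existence of the coupling\<close>

context lsc_density
begin

text \<open>At points of \<open>H\<close> the joint density summed over the levels is
  \<open>f\<close>, because the increments \<open>c\<close> add up to the limit of
  \<open>\<iota>\<close>; the rest of \<open>J\<close> is null.\<close>

lemma joint_density_marginal:
  assumes f: "(\<lambda>x. ennreal (f x)) \<in> borel_measurable (restrict_space lborel J)"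
    and B: "B \<in> sets borel" "B \<subseteq> J"
  shows "(\<integral>\<^sup>+p. (case p of (x, n) \<Rightarrow> ennreal (joint_density A Is H f x n)) * indicator (B \<times> UNIV) p
      \<partial>ref_measure H) = emeasure (density (restrict_space lborel J) (\<lambda>x. ennreal (f x))) B"
proof -
  have B': "B \<times> UNIV \<in> sets (ref_measure H)"
    unfolding sets_ref_measure using B by auto
  have "J - H \<in> null_sets lborel"
    using H_full borel_J borel_H by (simp add: null_sets_def)
  then have ae: "AE x in lborel. x \<notin> J - H" by (rule AE_not_in)
  have val: "(\<Sum>k. ennreal (joint_density A Is H f x k) * indicator (B \<times> UNIV) (x, k)) * indicator H x =
      ennreal (f x) * indicator B x * indicator H x" for x
  proof (cases "x \<in> B \<inter> H")
    case True
    then have "(\<lambda>k. joint_density A Is H f x k) sums f x"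
      using c_digit_prefix_sums[of x] by (simp add: joint_density_def)
    then have "(\<Sum>k. ennreal (joint_density A Is H f x k)) = ennreal (f x)"
      using joint_density_nonneg suminf_ennreal2 sums_iff by metis
    then show ?thesis using True by simp
  next
    case False
    then show ?thesis by (auto simp: indicator_def)
  qed
  have "(\<integral>\<^sup>+p. (case p of (x, n) \<Rightarrow> ennreal (joint_density A Is H f x n)) * indicator (B \<times> UNIV) p
      \<partial>ref_measure H) = (\<integral>\<^sup>+x. ennreal (f x) * indicator B x * indicator H x \<partial>lborel)"
    using measurable_joint_density B' by (subst nn_integral_ref_measure) (auto simp: val)
  also have "\<dots> = (\<integral>\<^sup>+x. ennreal (f x) * indicator B x * indicator J x \<partial>lborel)"
  proof (rule nn_integral_cong_AE)
    show "AE x in lborel. ennreal (f x) * indicator B x * indicator H x =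
        ennreal (f x) * indicator B x * indicator J x"
      using ae by eventually_elim (use H_subset in \<open>auto simp: indicator_def\<close>)
  qed
  also have "\<dots> = (\<integral>\<^sup>+x. ennreal (f x) * indicator B x \<partial>restrict_space lborel J)"
    using borel_J by (subst nn_integral_restrict_space) auto
  also have "\<dots> = emeasure (density (restrict_space lborel J) (\<lambda>x. ennreal (f x))) B"
    using f B borel_J by (subst emeasure_density) (auto simp: sets_restrict_space_iff)
  finally show ?thesis .
qed

text \<open>The space carries the joint law \<open>K\<close> of position and level together with an
  independent uniform coordinate for \<open>E0\<close>.\<close>

lemma ex_digit_coupling:
  assumes f: "(\<lambda>x. ennreal (f x)) \<in> borel_measurable (restrict_space lborel J)"
    and prob: "prob_space (density (restrict_space lborel J) (\<lambda>x. ennreal (f x)))"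
  shows "\<exists>(M' :: (real \<times> nat \<times> real) measure) X N E0.
      prob_space M' \<and> X \<in> M' \<rightarrow>\<^sub>M restrict_space lborel J
      \<and> distr M' (restrict_space lborel J) X = density (restrict_space lborel J) (\<lambda>x. ennreal (f x))
      \<and> N \<in> M' \<rightarrow>\<^sub>M count_space UNIV
      \<and> distributed M' (ref_measure H) (\<lambda>\<omega>. (X \<omega>, N \<omega>)) (\<lambda>(x, n). ennreal (joint_density A Is H f x n))
      \<and> auxiliary_E0 A Is M' X N E0"
proof -
  let ?g = "\<lambda>(x, n). ennreal (joint_density A Is H f x n)"
  let ?F = "density (restrict_space lborel J) (\<lambda>x. ennreal (f x))"
  define K where "K = density (ref_measure H) ?g"
  define Q where "Q = uniform_measure lborel {0<..<len Is []}"
  have sets_K: "sets K = sets (borel \<Otimes>\<^sub>M count_space UNIV)"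
    by (simp add: K_def sets_ref_measure)
  have space_K: "space K = UNIV" by (simp add: K_def space_ref_measure)
  have mK: "measurable K L = measurable (borel \<Otimes>\<^sub>M count_space UNIV) L" for L :: "'z measure"
    by (rule measurable_cong_sets[OF sets_K refl])
  have mref: "measurable L (ref_measure H) = measurable L (borel \<Otimes>\<^sub>M count_space UNIV)" for L :: "'z measure"
    by (rule measurable_cong_sets[OF refl sets_ref_measure])
  have K_B: "emeasure K (B \<times> UNIV) = emeasure ?F B" if "B \<in> sets borel" "B \<subseteq> J" for B
    unfolding K_def joint_density_marginal[OF f that, symmetric]
    using that by (intro emeasure_density measurable_joint_density) (auto simp: sets_ref_measure)
  \<comment> \<open>The joint density vanishes off \<open>H\<close>, which is contained in
    \<open>J\<close>.\<close>
  have AE_J: "AE p in K. fst p \<in> J"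
    unfolding K_def using measurable_joint_density H_J
    by (subst AE_density) (auto simp: joint_density_def intro!: AE_I2 split: if_splits)
  have J_UNIV: "J \<times> UNIV \<in> sets K" using borel_J by (auto simp: sets_K)
  have "emeasure K (space K) = emeasure K (J \<times> UNIV)"
    using AE_J J_UNIV by (intro emeasure_eq_AE) auto
  also have "\<dots> = emeasure ?F (space ?F)"
    using K_B[OF borel_J order_refl] by (simp add: space_restrict_space)
  also have "\<dots> = 1" using prob by (rule prob_space.emeasure_space_1)
  finally have "prob_space K" by (rule prob_spaceI)
  interpret K: prob_space K by fact
  interpret Q: prob_space Q unfolding Q_def by (rule prob_space_uniform_interval[OF len_Nil_pos])
  interpret P: pair_prob_space K Q ..
  have sets_Q: "sets Q = sets borel" by (simp add: Q_def)
  define R where "R = (borel :: real measure) \<Otimes>\<^sub>M (count_space (UNIV :: nat set) \<Otimes>\<^sub>M (borel :: real measure))"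
  \<comment> \<open>Only regroups the coordinates: the product of \<open>K\<close> and
    \<open>Q\<close> nests the pairs to the left, the required type nests them to the right.\<close>
  define \<phi> where "\<phi> = (\<lambda>q :: (real \<times> nat) \<times> real. (fst (fst q), snd (fst q), snd q))"
  have sets_P: "sets (K \<Otimes>\<^sub>M Q) = sets ((borel \<Otimes>\<^sub>M count_space UNIV) \<Otimes>\<^sub>M borel)"
    by (intro sets_pair_measure_cong sets_K sets_Q)
  have \<phi>: "\<phi> \<in> K \<Otimes>\<^sub>M Q \<rightarrow>\<^sub>M R"
    unfolding measurable_cong_sets[OF sets_P refl] \<phi>_def R_def by measurable
  define M' where "M' = distr (K \<Otimes>\<^sub>M Q) R \<phi>"
  have "prob_space M'" unfolding M'_def using \<phi> by (rule P.prob_space_distr)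
  interpret M': prob_space M' by fact
  have mM': "measurable M' L = measurable R L" for L :: "'z measure"
    by (rule measurable_cong_sets) (auto simp: M'_def)
  obtain x0 where x0: "x0 \<in> J"
  proof -
    have "J \<noteq> {}" using prob_space.not_empty[OF prob] by (simp add: space_restrict_space)
    then show ?thesis using that by auto
  qed
  \<comment> \<open>\<open>K\<close> is a measure on all pairs, whereas a random variable with
    values in \<open>J\<close> must take them everywhere. Sending the other points to some
    \<open>x0\<close> in \<open>J\<close> changes X on a null set only.\<close>
  define h where "h x = (if x \<in> J then x else x0)" for x
  have h[measurable]: "h \<in> borel_measurable borel"
    unfolding h_def[abs_def] using borel_J by measurable
  define X where "X = (\<lambda>\<omega> :: real \<times> nat \<times> real. h (fst \<omega>))"
  define N where "N = (\<lambda>\<omega> :: real \<times> nat \<times> real. fst (snd \<omega>))"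
  define E0 where "E0 = (\<lambda>\<omega> :: real \<times> nat \<times> real. snd (snd \<omega>))"
  have N: "N \<in> M' \<rightarrow>\<^sub>M count_space UNIV" and E0: "E0 \<in> borel_measurable M'"
    and X_borel: "X \<in> borel_measurable M'"
    unfolding mM' R_def X_def N_def E0_def by measurable
  have X: "X \<in> M' \<rightarrow>\<^sub>M restrict_space lborel J"
    using X_borel x0 by (intro measurable_restrict_space2) (auto simp: X_def h_def)
  have XN: "(\<lambda>\<omega>. (X \<omega>, N \<omega>)) \<in> M' \<rightarrow>\<^sub>M ref_measure H"
    unfolding mref using X_borel N by measurable
  have hK: "(\<lambda>p. (h (fst p), snd p)) \<in> K \<rightarrow>\<^sub>M ref_measure H"
    unfolding mref mK by measurable
  have "distr M' (ref_measure H) (\<lambda>\<omega>. (X \<omega>, N \<omega>)) =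
      distr (K \<Otimes>\<^sub>M Q) (ref_measure H) ((\<lambda>\<omega>. (X \<omega>, N \<omega>)) \<circ> \<phi>)"
    using XN \<phi> unfolding M'_def by (intro distr_distr) (auto simp: M'_def)
  also have "(\<lambda>\<omega>. (X \<omega>, N \<omega>)) \<circ> \<phi> = (\<lambda>p. (h (fst p), snd p)) \<circ> fst"
    by (auto simp: X_def N_def \<phi>_def)
  also have "distr (K \<Otimes>\<^sub>M Q) (ref_measure H) \<dots> =
      distr (distr (K \<Otimes>\<^sub>M Q) K fst) (ref_measure H) (\<lambda>p. (h (fst p), snd p))"
    using hK by (intro distr_distr[symmetric]) auto
  also have "distr (K \<Otimes>\<^sub>M Q) K fst = K" by (rule Q.distr_pair_fst)
  also have "distr K (ref_measure H) (\<lambda>p. (h (fst p), snd p)) = distr K (ref_measure H) (\<lambda>p. p)"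
    using AE_J hK by (intro distr_cong_AE) (auto simp: h_def K_def)
  also have "\<dots> = K" by (rule distr_id2) (simp add: K_def)
  finally have joint: "distributed M' (ref_measure H) (\<lambda>\<omega>. (X \<omega>, N \<omega>)) ?g"
    using XN measurable_joint_density by (simp add: distributed_def K_def)
  have law_X: "distr M' (restrict_space lborel J) X = ?F"
  proof (rule measure_eqI)
    fix B assume "B \<in> sets (distr M' (restrict_space lborel J) X)"
    then have B: "B \<in> sets (restrict_space lborel J)" by simp
    then have B': "B \<in> sets borel" "B \<subseteq> J" using borel_J by (auto simp: sets_restrict_space_iff)
    have "emeasure (distr M' (restrict_space lborel J) X) B = emeasure M' (X -` B \<inter> space M')"
      using X B by (rule emeasure_distr)
    also have "\<dots> = emeasure M' ((\<lambda>\<omega>. (X \<omega>, N \<omega>)) -` (B \<times> UNIV) \<inter> space M')"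
      by (rule arg_cong[of _ _ "emeasure M'"]) auto
    also have "\<dots> = (\<integral>\<^sup>+p. ?g p * indicator (B \<times> UNIV) p \<partial>ref_measure H)"
      using B' by (intro distributed_emeasure[OF joint]) (auto simp: sets_ref_measure)
    also have "\<dots> = emeasure ?F B" by (rule joint_density_marginal[OF f B'])
    finally show "emeasure (distr M' (restrict_space lborel J) X) B = emeasure ?F B" .
  qed simp
  interpret digit_coupling A I Is D H f M' X N
    using X N joint by unfold_locales
  have E0_N: "\<P>(\<omega> in M'. N \<omega> = 0 \<and> E0 \<omega> \<in> B) = \<P>(\<omega> in M'. N \<omega> = 0) * measure Q B"
    if B: "B \<in> sets borel" for B
  proof -
    have "emeasure M' {\<omega> \<in> space M'. N \<omega> = 0 \<and> E0 \<omega> \<in> C} = emeasure K (UNIV \<times> {0}) * emeasure Q C"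
      if C: "C \<in> sets borel" for C
    proof -
      have "{\<omega> \<in> space M'. N \<omega> = 0 \<and> E0 \<omega> \<in> C} = UNIV \<times> {0} \<times> C"
        by (auto simp: M'_def R_def space_pair_measure N_def E0_def)
      moreover have "UNIV \<times> {0} \<times> C \<in> sets R" using C by (auto simp: R_def)
      moreover have "\<phi> -` (UNIV \<times> {0} \<times> C) \<inter> space (K \<Otimes>\<^sub>M Q) = (UNIV \<times> {0}) \<times> C"
        using space_K by (auto simp: \<phi>_def space_pair_measure Q_def)
      moreover have "emeasure (K \<Otimes>\<^sub>M Q) ((UNIV \<times> {0}) \<times> C) = emeasure K (UNIV \<times> {0}) * emeasure Q C"
        using C by (intro Q.emeasure_pair_measure_Times) (auto simp: sets_K sets_Q)
      ultimately show ?thesis using \<phi> by (simp add: M'_def emeasure_distr)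
    qed
    \<comment> \<open>The instance with \<open>UNIV\<close> identifies the factor
      \<open>emeasure K (UNIV \<times> {0})\<close> as the probability that \<open>N\<close> is
      0.\<close>
    note * = this[OF B] this[of UNIV]
    have "emeasure Q UNIV = 1" using Q.emeasure_space_1 by (simp add: Q_def)
    then show ?thesis using * by (simp add: measure_def enn2real_mult)
  qed
  have "auxiliary_E0 A Is M' X N E0"
    unfolding auxiliary_E0_def has_unif_law_def
  proof (intro conjI impI E0)
    assume pos: "\<P>(\<omega> in M'. N \<omega> = 0) > 0"
    have N0: "{\<omega> \<in> space M'. N \<omega> = 0} \<in> sets M'"
      using measurable_sets[OF N, of "{0}"] by (simp add: vimage_def Int_def conj_commute)
    have eq: "\<P>(\<omega> in M'. N \<omega> = 0 \<and> S \<omega> = s \<and> E0 \<omega> \<in> B) = \<P>(\<omega> in M'. N \<omega> = 0 \<and> S \<omega> = s) * measure Q B"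
      if B: "B \<in> sets borel" for s B
    \<comment> \<open>Where \<open>N\<close> is 0, \<open>S\<close> is constantly the empty word, so
      the product formula reduces to \<open>E0_N\<close> and is trivial for other words.\<close>
    proof (cases "s = []")
      case True
      have "{\<omega> \<in> space M'. N \<omega> = 0 \<and> S \<omega> = s \<and> E0 \<omega> \<in> B} = {\<omega> \<in> space M'. N \<omega> = 0 \<and> E0 \<omega> \<in> B}"
          "{\<omega> \<in> space M'. N \<omega> = 0 \<and> S \<omega> = s} = {\<omega> \<in> space M'. N \<omega> = 0}"
        using True S_eq_Nil_iff by auto
      then show ?thesis using E0_N[OF B] by (simp only:)
    next
      case False
      then have "{\<omega> \<in> space M'. N \<omega> = 0 \<and> S \<omega> = s \<and> E0 \<omega> \<in> B} = {}"
          "{\<omega> \<in> space M'. N \<omega> = 0 \<and> S \<omega> = s} = {}"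
        using S_eq_Nil_iff by auto
      then show ?thesis by (simp only: measure_empty mult_zero_left)
    qed
    note * = indep_rv_and_law_given[OF M'.prob_space_axioms countable_lists[OF countable_alphabet]
        measurable_S E0 N0 pos Q.prob_space_axioms sets_Q eq]
    show ind: "indep_rv (given M' (\<lambda>\<omega>. N \<omega> = 0)) (count_space (lists A)) S borel E0"
      by (rule *(1))
    show "distr (given M' (\<lambda>\<omega>. N \<omega> = 0)) lborel E0 = uniform_measure lborel {0<..<len Is []}"
      using *(2) by (simp only: Q_def)
    show "E0 \<in> borel_measurable (given M' (\<lambda>\<omega>. N \<omega> = 0))"
      using ind by (simp add: indep_rv_def)
  qed
  then show ?thesis
    using \<open>prob_space M'\<close> X law_X N joint by blast
qed

end

theorem theorem3p1:
  fixes A :: "'d set" and I :: "real set" and Is :: "'d list \<Rightarrow> real set" and D :: "nat \<Rightarrow> real set"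
    and M :: "'a measure" and X :: "'a \<Rightarrow> real" and f :: "real \<Rightarrow> real" and H J :: "real set"
  assumes subdivision: "nested_subdivision A I Is D"
    and J_def: "J = regular_points I D"
    and M: "prob_space M"
    and f_nonneg: "\<forall>x\<in>J. 0 \<le> f x"
    and X_density: "distributed M (restrict_space lborel J) X (\<lambda>x. ennreal (f x))"
    and H_borel: "H \<in> sets borel"
    and H_subset: "H \<subseteq> J"
    and H_full: "emeasure lborel (J - H) = 0"
    and lsc: "lsc_within J H f"
  shows
    "(\<forall>x\<in>H. \<forall>n. 0 \<le> joint_density A Is H f x n)
     \<and> (\<exists>(M' :: (real \<times> nat \<times> real) measure) X' N E0.
           coupling J M X M' X' N
         \<and> distributed M' (ref_measure H) (\<lambda>\<omega>. (X' \<omega>, N \<omega>)) (\<lambda>(x, n). ennreal (joint_density A Is H f x n))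
         \<and> auxiliary_E0 A Is M' X' N E0)
     \<and> (\<forall>(M' :: 'b measure) X' N E0.
           coupling J M X M' X' N
         \<and> distributed M' (ref_measure H) (\<lambda>\<omega>. (X' \<omega>, N \<omega>)) (\<lambda>(x, n). ennreal (joint_density A Is H f x n))
         \<and> auxiliary_E0 A Is M' X' N E0
         \<longrightarrow>
         (let S = S_of A Is X' N; R = R_of A Is X' N; L = L_of A Is X' N;
              E = E_of A Is X' N E0; U = U_of A Is X' N E0
          in
             (\<forall>n. \<forall>xs\<in>words A n. \<P>(\<omega> in M'. S \<omega> = xs) = c_fun Is H f xs * len Is xs)
           \<and> (\<forall>n. ((\<lambda>xs. inf_fun Is H f xs * len Is xs) has_sum \<P>(\<omega> in M'. N \<omega> \<le> n)) (words A n))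
           \<and> (\<forall>n. \<forall>x\<in>H. f x > 0 \<longrightarrow>
                cond_prob_le (joint_density A Is H f) f n x = inf_fun Is H f (digit_prefix A Is x n) / f x)
           \<and> indep_rv M' (count_space (lists A)) S borel U
           \<and> has_unif_law M' U 1
           \<and> (\<forall>m n. \<forall>xs\<in>words A n. \<forall>ys\<in>words A m. m \<ge> 1 \<and> \<P>(\<omega> in M'. S \<omega> = xs) > 0 \<longrightarrow>
                \<P>(\<omega> in M'. (\<forall>k<m. R \<omega> k = ys ! k) \<bar> S \<omega> = xs) = len Is (xs @ ys) / len Is xs)
           \<and> (\<forall>l. \<P>(\<omega> in M'. L \<omega> = l) > 0 \<longrightarrow>
                indep_rv (given M' (\<lambda>\<omega>. L \<omega> = l)) (count_space (lists A)) S borel E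
              \<and> has_unif_law (given M' (\<lambda>\<omega>. L \<omega> = l)) E l)))"
proof -
  interpret nested_subdivision A I Is D by fact
  interpret lsc_density A I Is D H f
    using f_nonneg H_borel H_subset H_full lsc by unfold_locales (auto simp: J_def)
  have f: "(\<lambda>x. ennreal (f x)) \<in> borel_measurable (restrict_space lborel J)"
    and law: "distr M (restrict_space lborel J) X = density (restrict_space lborel J) (\<lambda>x. ennreal (f x))"
    and X: "X \<in> M \<rightarrow>\<^sub>M restrict_space lborel J"
    using X_density by (auto simp: distributed_def)
  have prob: "prob_space (density (restrict_space lborel J) (\<lambda>x. ennreal (f x)))"
    using prob_space.prob_space_distr[OF M X] by (simp only: law)
  show ?thesis
  proof (intro conjI allI impI)
    show "\<forall>x\<in>H. \<forall>n. 0 \<le> joint_density A Is H f x n"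
      using joint_density_nonneg by blast
    show "\<exists>(M' :: (real \<times> nat \<times> real) measure) X' N E0.
           coupling J M X M' X' N
         \<and> distributed M' (ref_measure H) (\<lambda>\<omega>. (X' \<omega>, N \<omega>)) (\<lambda>(x, n). ennreal (joint_density A Is H f x n))
         \<and> auxiliary_E0 A Is M' X' N E0"
      \<comment> \<open>The law of \<open>X\<close> under \<open>M\<close> is the measure with
        density \<open>f\<close> on \<open>J\<close>, which is also the first marginal of the
        constructed measure.\<close>
      unfolding coupling_def law using ex_digit_coupling[folded J_def, OF f prob] by blast
  next
    fix M' :: "'b measure" and X' N E0
    assume *: "coupling J M X M' X' N
         \<and> distributed M' (ref_measure H) (\<lambda>\<omega>. (X' \<omega>, N \<omega>)) (\<lambda>(x, n). ennreal (joint_density A Is H f x n))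
         \<and> auxiliary_E0 A Is M' X' N E0"
    then interpret M': prob_space M' by (simp add: coupling_def)
    interpret digit_coupling_E0 A I Is D H f M' X' N E0
      using * by unfold_locales (auto simp: coupling_def J_def)
    have "cond_prob_le (joint_density A Is H f) f n x = inf_fun Is H f (digit_prefix A Is x n) / f x"
      if "x \<in> H" for n x
      using that sum_c_digit_prefix[of x n] by (simp add: cond_prob_le_def joint_density_def)
    then show "let S = S_of A Is X' N; R = R_of A Is X' N; L = L_of A Is X' N;
              E = E_of A Is X' N E0; U = U_of A Is X' N E0
          in
             (\<forall>n. \<forall>xs\<in>words A n. \<P>(\<omega> in M'. S \<omega> = xs) = c_fun Is H f xs * len Is xs)
           \<and> (\<forall>n. ((\<lambda>xs. inf_fun Is H f xs * len Is xs) has_sum \<P>(\<omega> in M'. N \<omega> \<le> n)) (words A n))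
           \<and> (\<forall>n. \<forall>x\<in>H. f x > 0 \<longrightarrow>
                cond_prob_le (joint_density A Is H f) f n x = inf_fun Is H f (digit_prefix A Is x n) / f x)
           \<and> indep_rv M' (count_space (lists A)) S borel U
           \<and> has_unif_law M' U 1
           \<and> (\<forall>m n. \<forall>xs\<in>words A n. \<forall>ys\<in>words A m. m \<ge> 1 \<and> \<P>(\<omega> in M'. S \<omega> = xs) > 0 \<longrightarrow>
                \<P>(\<omega> in M'. (\<forall>k<m. R \<omega> k = ys ! k) \<bar> S \<omega> = xs) = len Is (xs @ ys) / len Is xs)
           \<and> (\<forall>l. \<P>(\<omega> in M'. L \<omega> = l) > 0 \<longrightarrow>
                indep_rv (given M' (\<lambda>\<omega>. L \<omega> = l)) (count_space (lists A)) S borel E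
              \<and> has_unif_law (given M' (\<lambda>\<omega>. L \<omega> = l)) E l)"
      unfolding Let_def
      using prob_S has_sum_prob_N_le indep_S_U law_U cond_prob_R indep_S_E_given_L law_E_given_L
      by (intro conjI allI ballI impI) auto
  qed
qed

end
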